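(* Let $K=\mathbb{C}[u_1,\dots,u_4]$, and let $I$, $\widetilde\phi_1,\dots,\widetilde\phi_4$ and $\widetilde{\partial_xW}$ be the ideal and polynomials in $K[x,a,b,c]$ defined in the context. For every $i,j\in\{1,2,3,4\}$ there exist unique homogeneous polynomials $C_{ij}^k\in K$ $(k=1,\dots,4)$ and a unique $\widetilde Q_{ij}\in K[x,a,b,c]/I$ of the form $$\widetilde Q_{ij}=ab\,p_{ij1}(x)+a\,p_{ij2}(x)+b\,p_{ij3}(x)+abc\,p_{ij4}(x)+ac\,p_{ij5}(x)+bc\,p_{ij6}(x),$$ with each $p_{ijm}\in K[x]$ homogeneous of the degree specified in the context, such that in $K[x,a,b,c]/I$ $$\widetilde\phi_i\widetilde\phi_j=\sum_{k=1}^4 C_{ij}^k\,\widetilde\phi_k\widetilde\phi_4+\widetilde Q_{ij}\,\widetilde{\partial_xW}.$$ Moreover, writing $M_i$ for the $4\times4$ matrix whose entry in row $k$ and column $j$ is $C_{ij}^k$, one has that $M_4$ is the identity matrix and $$M_1=\begin{pmatrix} u_1\left(\frac{250}{243}u_1^4-\frac{10}{9}u_1u_2-\frac73u_3\right) & -\frac{25}{54}u_1^3+\frac14u_2 & -\frac53u_1^2 & 1\\ \frac{100}{81}u_1^4u_2+\frac{140}{27}u_1^3u_3-\frac23u_1u_2^2-\frac43u_1u_4-2u_2u_3 & u_1\left(-\frac59u_1u_2-\frac73u_3\right) & -6u_3-2u_1u_2 & 0\\ -\frac29u_1u_2u_3-\frac23u_3^2+\frac{100}{243}u_1^4u_3-\frac{10}{27}u_1^2u_4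 & \frac16u_4-\frac5{27}u_1^2u_3 & -\frac23u_1u_3 & 0\\ \frac{10}9u_1^2u_3^2-\frac13u_1u_2u_4-u_3u_4+\frac{50}{81}u_1^4u_4 & -\frac12u_3^2-\frac5{18}u_1^2u_4 & -u_1u_4 & 0 \end{pmatrix},$$ $$M_2=\begin{pmatrix} -\frac{25}{54}u_1^3+\frac14u_2 & \frac5{24}u_1 & \frac34 & 0\\ u_1\left(-\frac59u_1u_2-\frac73u_3\right) & \frac14u_2 & 0 & 1\\ \frac16u_4-\frac5{27}u_1^2u_3 & \frac1{12}u_3 & 0 & 0\\ -\frac12u_3^2-\frac5{18}u_1^2u_4 & \frac18u_4 & 0 & 0 \end{pmatrix},\qquad M_3=\begin{pmatrix} -\frac53u_1^2 & \frac34 & 0 & 0\\ -6u_3-2u_1u_2 & 0 & -6u_1 & 0\\ -\frac23u_1u_3 & 0 & 0 & 1\\ -u_1u_4 & 0 & -\frac92u_3 & 0 \end{pmatrix}.$$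
   Context: Let $K=\mathbb{C}[u_1,u_2,u_3,u_4]$ and define $b_1,b_2,b_3,p,q\in K[x]$ by $b_1=-636x^9-300u_1x^7-48u_1^2x^5-5u_2x^3+2u_3x$, $b_2=-168x^{18}-348u_1x^{16}-276u_1^2x^{14}+(-116u_1^3+14u_2)x^{12}+(-92u_3-20u_1^4-8u_1u_2)x^{10}+(-42u_1u_3-6u_1^2u_2)x^8+(-4u_4-\frac{10}{3}u_1^2u_3-\frac23u_2^2)x^6+(\frac13u_2u_3-\frac23u_4u_1)x^4$, $b_3=x^{27}+6u_1x^{25}+15u_1^2x^{23}+(20u_1^3+u_2)x^{21}+(5u_3+4u_1u_2+15u_1^4)x^{19}+(6u_1^2u_2+12u_1u_3+6u_1^5)x^{17}+(\frac13u_2^2+5u_4+4u_1^3u_2+\frac{26}{3}u_1^2u_3+u_1^6)x^{15}+(\frac43u_1^3u_3+\frac{19}{3}u_4u_1+u_1^4u_2+\frac43u_2u_3+\frac23u_2^2u_1)x^{13}+(\frac13u_1^2u_2^2-\frac13u_1^4u_3-\frac{15}{4}u_3^2+3u_4u_1^2)x^{11}+(\frac13u_4u_2-\frac49u_1^2u_2u_3+\frac1{27}u_2^3-\frac{13}{6}u_3^2u_1+\frac{13}{27}u_4u_1^3)x^9+(-\frac19u_2^2u_3-\frac12u_4u_3+\frac19u_4u_1u_2-\frac7{36}u_1^2u_3^2)x^7+(\frac1{12}u_3^2u_2-\frac16u_4u_1u_3)x^5+(-\frac1{54}u_3^3-\frac1{108}u_4^2)x^3$, $p=-\frac{b_2}{6}-\frac{b_1^2}{144}$,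 $\quad q=\frac1{27}\left(\frac{b_1^3}{32}+\frac98b_1b_2+27b_3\right)$. The (pure $F_4$ Seiberg–Witten) curve is $z+\mu/z=W$ with $W=\frac{b_1}{24}-\frac1{2p}(a+b)$, where $c=\sqrt{q^2+4p^3}$, $a=p\left(\frac{-q+c}{2}\right)^{1/3}$, $b=p\left(\frac{-q-c}{2}\right)^{1/3}$, the cube roots being chosen so that $ab=-p^3$. Set $\phi_i=-\partial W/\partial u_i$, $\widetilde\phi_i=abc\,\phi_i$ and $\widetilde{\partial_xW}=abc\,\partial_xW$. Regarding $x,a,b,c$ as independent variables, $I\subset K[x,a,b,c]$ is the ideal generated by $$c^2-q^2-4p^3,\quad ab+p^3,\quad a^2-\tfrac12(q-c)b,\quad b^2-\tfrac12(q+c)a .$$ For a derivation $D\in\{\partial_{u_1},\dots,\partial_{u_4},\partial_x\}$ of $K[x]$ put $$F_D=-\tfrac1{24}\,abc\,D(b_1)+\tfrac16p^2D(q)(a-b)-\tfrac14\,p\,D(p)\big(a(q+c)+b(c-q)\big)\in K[x,a,b,c].$$ As polynomials, $\widetilde\phi_i$ and $\widetilde{\partial_xW}$ are represented modulo $I$ by $\widetilde\phi_i=F_{\partial_{u_i}}$ and $\widetilde{\partial_xW}=-F_{\partial_x}$. Grading: $[x]=1$, $[u_1]=2$, $[u_2]=6$, $[u_3]=8$, $[u_4]=12$, which gives $[a]=[b]=[c]=27$ and $([\phi_1],[\phi_2],[\phi_3],[\phi_4])=(7,3,1,-3)$, $[\partial_xW]=8$. Each $C_{ij}^k$ is required to be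 homogeneous of degree $[\phi_i]+[\phi_j]-[\phi_k]-[\phi_4]$. Put $d_{ij}=[\phi_i]+[\phi_j]-8$; then $p_{ij1},p_{ij5},p_{ij6}$ are required to be homogeneous (in $x,u_1,\dots,u_4$) of degree $d_{ij}+27$, $p_{ij2},p_{ij3}$ of degree $d_{ij}+54$, and $p_{ij4}$ of degree $d_{ij}$. The zero polynomial is considered homogeneous of every degree, and it is the only homogeneous polynomial of negative degree. *)

theory Defs
  imports
    "HOL-Analysis.Cartesian_Space"
    "HOL-Library.Poly_Mapping"
    "HOL-Algebra.QuotRing"
    "HOL-Decision_Procs.Algebra_Aux"
begin

section \<open>The polynomial ring \<open>K[x,a,b,c]\<close>\<close>

text \<open>
  The indeterminates are \<open>u\<^sub>1, \<dots>, u\<^sub>4, x, a, b, c\<close>, and a monomial is an exponent vector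
  \<open>indet \<Rightarrow>\<^sub>0 nat\<close>. The whole type \<open>poly8\<close> is \<open>\<complex>[u\<^sub>1,\<dots>,u\<^sub>4,x,a,b,c] = K[x,a,b,c]\<close>;
  the rings \<open>K\<close> and \<open>K[x]\<close> are the subsets of polynomials in the respective indeterminates.
  Indices in \<open>{1,2,3,4}\<close> are elements of the four-element type \<open>4\<close> (in which \<open>4 = 0\<close>).
\<close>

datatype indet = U 4 | X | A | B | C

type_synonym poly8 = "(indet \<Rightarrow>\<^sub>0 nat) \<Rightarrow>\<^sub>0 complex"

definition ind :: "indet \<Rightarrow> poly8"
  where "ind v = Poly_Mapping.single (Poly_Mapping.single v 1) 1"

definition cst :: "complex \<Rightarrow> poly8"
  where "cst r = Poly_Mapping.single 0 r"

abbreviation "u1 \<equiv> ind (U 1)"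
abbreviation "u2 \<equiv> ind (U 2)"
abbreviation "u3 \<equiv> ind (U 3)"
abbreviation "u4 \<equiv> ind (U 4)"
abbreviation "xv \<equiv> ind X"
abbreviation "av \<equiv> ind A"
abbreviation "bv \<equiv> ind B"
abbreviation "cv \<equiv> ind C"

definition polys_in :: "indet set \<Rightarrow> poly8 set"
  where "polys_in V = {f. \<forall>m \<in> Poly_Mapping.keys f. Poly_Mapping.keys m \<subseteq> V}"

definition K :: "poly8 set"
  where "K = polys_in (range U)"

definition Kx :: "poly8 set"
  where "Kx = polys_in (insert X (range U))"

text \<open>In \<open>pd\<close>, the exponent subtraction is truncated, but a term in which \<open>v\<close> does not occur
  has coefficient \<open>0\<close>.\<close>

definition pd :: "indet \<Rightarrow> poly8 \<Rightarrow> poly8"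
  where "pd v f = (\<Sum>m \<in> Poly_Mapping.keys f.
    Poly_Mapping.single (m - Poly_Mapping.single v 1)
      (of_nat (Poly_Mapping.lookup m v) * Poly_Mapping.lookup f m))"


section \<open>The grading\<close>

fun wt :: "indet \<Rightarrow> int" where
  "wt (U i) = (vector [2, 6, 8, 12] :: int^4) $ i"
| "wt X = 1"
| "wt A = 27"
| "wt B = 27"
| "wt C = 27"

definition mono_deg :: "(indet \<Rightarrow>\<^sub>0 nat) \<Rightarrow> int"
  where "mono_deg m = (\<Sum>v \<in> Poly_Mapping.keys m. int (Poly_Mapping.lookup m v) * wt v)"

definition homogeneous :: "int \<Rightarrow> poly8 \<Rightarrow> bool"
  where "homogeneous d f \<longleftrightarrow> (\<forall>m \<in> Poly_Mapping.keys f. mono_deg m = d)"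

definition deg_phi :: "4 \<Rightarrow> int"
  where "deg_phi i = (vector [7, 3, 1, -3] :: int^4) $ i"


section \<open>The data of the \<open>F\<^sub>4\<close> curve\<close>

definition b1 :: poly8 where
  "b1 = - 636 * xv^9 - 300 * u1 * xv^7 - 48 * u1^2 * xv^5 - 5 * u2 * xv^3 + 2 * u3 * xv"

definition b2 :: poly8 where
  "b2 = - 168 * xv^18 - 348 * u1 * xv^16 - 276 * u1^2 * xv^14
    + (- 116 * u1^3 + 14 * u2) * xv^12
    + (- 92 * u3 - 20 * u1^4 - 8 * u1 * u2) * xv^10
    + (- 42 * u1 * u3 - 6 * u1^2 * u2) * xv^8
    + (- 4 * u4 - cst (10/3) * u1^2 * u3 - cst (2/3) * u2^2) * xv^6
    + (cst (1/3) * u2 * u3 - cst (2/3) * u4 * u1) * xv^4"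

definition b3 :: poly8 where
  "b3 = xv^27 + 6 * u1 * xv^25 + 15 * u1^2 * xv^23
    + (20 * u1^3 + u2) * xv^21
    + (5 * u3 + 4 * u1 * u2 + 15 * u1^4) * xv^19
    + (6 * u1^2 * u2 + 12 * u1 * u3 + 6 * u1^5) * xv^17
    + (cst (1/3) * u2^2 + 5 * u4 + 4 * u1^3 * u2 + cst (26/3) * u1^2 * u3 + u1^6) * xv^15
    + (cst (4/3) * u1^3 * u3 + cst (19/3) * u4 * u1 + u1^4 * u2 + cst (4/3) * u2 * u3
        + cst (2/3) * u2^2 * u1) * xv^13
    + (cst (1/3) * u1^2 * u2^2 - cst (1/3) * u1^4 * u3 - cst (15/4) * u3^2
        + 3 * u4 * u1^2) * xv^11
    + (cst (1/3) * u4 * u2 - cst (4/9) * u1^2 * u2 * u3 + cst (1/27) * u2^3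
        - cst (13/6) * u3^2 * u1 + cst (13/27) * u4 * u1^3) * xv^9
    + (- cst (1/9) * u2^2 * u3 - cst (1/2) * u4 * u3 + cst (1/9) * u4 * u1 * u2
        - cst (7/36) * u1^2 * u3^2) * xv^7
    + (cst (1/12) * u3^2 * u2 - cst (1/6) * u4 * u1 * u3) * xv^5
    + (- cst (1/54) * u3^3 - cst (1/108) * u4^2) * xv^3"

definition p :: poly8 where
  "p = - cst (1/6) * b2 - cst (1/144) * b1^2"

definition q :: poly8 where
  "q = cst (1/27) * (cst (1/32) * b1^3 + cst (9/8) * b1 * b2 + 27 * b3)"

definition F :: "(poly8 \<Rightarrow> poly8) \<Rightarrow> poly8" where
  "F D = - cst (1/24) * av * bv * cv * D b1
    + cst (1/6) * p^2 * D q * (av - bv)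
    - cst (1/4) * p * D p * (av * (q + cv) + bv * (cv - q))"

text \<open>\<open>\<phi> i\<close> and \<open>dxW\<close> are the polynomial representatives of \<open>a b c \<phi>\<^sub>i = - a b c \<partial>W/\<partial>u\<^sub>i\<close>
  and \<open>a b c \<partial>\<^sub>xW\<close>.\<close>

definition \<phi> :: "4 \<Rightarrow> poly8"
  where "\<phi> i = F (pd (U i))"

definition dxW :: poly8
  where "dxW = - F (pd X)"


section \<open>The quotient ring \<open>K[x,a,b,c]/I\<close>\<close>

abbreviation R :: "poly8 ring"
  where "R \<equiv> cring_class_ops"

definition I :: "poly8 set" where
  "I = Idl\<^bsub>R\<^esub> {cv^2 - q^2 - 4 * p^3,
               av * bv + p^3,
               av^2 - cst (1/2) * (q - cv) * bv,
               bv^2 - cst (1/2) * (q + cv) * av}"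

abbreviation quot :: "poly8 set ring"
  where "quot \<equiv> R Quot I"

definition cls :: "poly8 \<Rightarrow> poly8 set"
  where "cls f = I +>\<^bsub>R\<^esub> f"


section \<open>The multiplication relations\<close>

definition admissible_Q :: "4 \<Rightarrow> 4 \<Rightarrow> poly8 set \<Rightarrow> bool" where
  "admissible_Q i j Q \<longleftrightarrow>
    (let d = deg_phi i + deg_phi j - 8 in
     \<exists>p1 \<in> Kx. \<exists>p2 \<in> Kx. \<exists>p3 \<in> Kx. \<exists>p4 \<in> Kx. \<exists>p5 \<in> Kx. \<exists>p6 \<in> Kx.
       homogeneous (d + 27) p1 \<and> homogeneous (d + 54) p2 \<and> homogeneous (d + 54) p3 \<and>
       homogeneous d p4 \<and> homogeneous (d + 27) p5 \<and> homogeneous (d + 27) p6 \<and>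
       Q = cls (av * bv * p1 + av * p2 + bv * p3 + av * bv * cv * p4
                + av * cv * p5 + bv * cv * p6))"

text \<open>In \<open>mult_rel i j c Q\<close>, the value \<open>c k\<close> is the coefficient \<open>C\<^sub>i\<^sub>j\<^sup>k\<close>.\<close>

definition mult_rel :: "4 \<Rightarrow> 4 \<Rightarrow> (4 \<Rightarrow> poly8) \<Rightarrow> poly8 set \<Rightarrow> bool" where
  "mult_rel i j c Q \<longleftrightarrow>
    (\<forall>k. c k \<in> K \<and> homogeneous (deg_phi i + deg_phi j - deg_phi k - deg_phi 4) (c k)) \<and>
    admissible_Q i j Q \<and>
    cls (\<phi> i * \<phi> j) =
      cls (\<Sum>k\<in>UNIV. c k * \<phi> k * \<phi> 4) \<oplus>\<^bsub>quot\<^esub> Q \<otimes>\<^bsub>quot\<^esub> cls dxW"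

end

theory Submission
  imports Defs "HOL-Computational_Algebra.Fundamental_Theorem_Algebra"
begin

text \<open>
  The function \<open>W\<close> is a root of the cubic \<open>G = b3 + b2 W + b1 W^2 - 8 W^3\<close>, so \<open>\<phi>\<^sub>i = G\<^sub>i / G\<^sub>W\<close> and
  \<open>\<partial>\<^sub>xW = - G\<^sub>x / G\<^sub>W\<close>, where \<open>G\<^sub>i = \<partial>G/\<partial>u\<^sub>i\<close>. Clearing \<open>G\<^sub>W\<close>, the relations become ideal memberships
  \<open>G\<^sub>i G\<^sub>j - (\<Sum>k. C\<^sub>k G\<^sub>k G\<^sub>4) = H G\<^sub>x + A G\<close> in \<open>K[x,W]\<close>, certified by explicit \<open>H\<close> and \<open>A\<close>, and \<open>H\<close> determines
  \<open>Q\<close>.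

  For uniqueness, a difference of two relations is evaluated at critical points of \<open>W\<close>, where
  \<open>\<partial>\<^sub>xW = 0\<close>. These have a polynomial parametrisation in which \<open>\<phi>\<^sub>1, \<phi>\<^sub>2, \<phi>\<^sub>3, \<phi>\<^sub>4\<close> are proportional to
  \<open>18 s e, - 9/2 e, - 3 s, 1\<close>. For fixed \<open>u\<^sub>1 \<noteq> 0\<close>, \<open>u\<^sub>2\<close>, \<open>u\<^sub>3\<close> the parameter \<open>s\<close> is free, \<open>u\<^sub>4\<close> has degree 4 in
  \<open>s\<close>, and the four factors have degrees 3, 2, 1, 0, which are distinct modulo 4; hence a relation
  with coefficients depending on \<open>u\<^sub>4\<close> is trivial. Finally \<open>Q\<close> vanishes because \<open>\<partial>\<^sub>xW\<close> is nonzero at the six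
  points of the curve over a generic \<open>(x, u)\<close>, and these determine the six components of \<open>Q\<close>.
\<close>

section \<open>Evaluation of polynomials\<close>

lemma UNIV_indet: "(UNIV :: indet set) = {U 1, U 2, U 3, U 4, X, A, B, C}"
proof -
  have "v \<in> {U 1, U 2, U 3, U 4, X, A, B, C}" for v
    using exhaust_4 by (cases v) auto
  then show ?thesis by auto
qed

lemma finite_UNIV_indet [simp]: "finite (UNIV :: indet set)"
  by (simp add: UNIV_indet)

lemma finite_indets [simp]: "finite (V :: indet set)"
  by (rule finite_subset [OF subset_UNIV finite_UNIV_indet])

definition monom_val :: "(indet \<Rightarrow> complex) \<Rightarrow> (indet \<Rightarrow>\<^sub>0 nat) \<Rightarrow> complex"
  where "monom_val z m = (\<Prod>v\<in>UNIV. z v ^ Poly_Mapping.lookup m v)"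

definition ev :: "(indet \<Rightarrow> complex) \<Rightarrow> poly8 \<Rightarrow> complex"
  where "ev z f = (\<Sum>m\<in>Poly_Mapping.keys f. Poly_Mapping.lookup f m * monom_val z m)"

lemma ev_superset:
  assumes "finite S" "Poly_Mapping.keys f \<subseteq> S"
  shows "ev z f = (\<Sum>m\<in>S. Poly_Mapping.lookup f m * monom_val z m)"
  unfolding ev_def using assms
  by (intro sum.mono_neutral_left) (auto simp: in_keys_iff)

lemma ev_add [simp]: "ev z (f + g) = ev z f + ev z g"
proof -
  let ?S = "Poly_Mapping.keys f \<union> Poly_Mapping.keys g"
  show ?thesis
    using keys_add [of f g]
    by (subst (1 2 3) ev_superset [of ?S])
       (auto simp: lookup_add sum.distrib distrib_right)
qed

lemma ev_zero [simp]: "ev z 0 = 0"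
  by (simp add: ev_def)

lemma ev_single: "ev z (Poly_Mapping.single m r) = r * monom_val z m"
  by (subst ev_superset [of "{m}"]) auto

lemma ev_sum: "ev z (sum f S) = (\<Sum>i\<in>S. ev z (f i))"
  by (induction S rule: infinite_finite_induct) auto

lemma poly_mapping_sum_singles:
  fixes f :: "'a \<Rightarrow>\<^sub>0 'b::comm_monoid_add"
  shows "f = (\<Sum>m\<in>Poly_Mapping.keys f. Poly_Mapping.single m (Poly_Mapping.lookup f m))"
  by (rule poly_mapping_eqI)
     (auto simp: lookup_sum lookup_single when_def in_keys_iff)

lemma poly_mapping_single_induct [case_names single add]:
  fixes f :: "'a \<Rightarrow>\<^sub>0 'b::comm_monoid_add"
  assumes single: "\<And>m r. P (Poly_Mapping.single m r)"
    and add: "\<And>f g. P f \<Longrightarrow> P g \<Longrightarrow> P (f + g)"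
  shows "P f"
proof -
  have "P (\<Sum>m\<in>S. Poly_Mapping.single m (g m))" if "finite S" for g :: "'a \<Rightarrow> 'b" and S
    using that
  proof induction
    case empty
    from single [of undefined 0] show ?case by simp
  qed (auto intro: single add)
  then show ?thesis
    by (subst poly_mapping_sum_singles) auto
qed

lemma monom_val_add: "monom_val z (m + n) = monom_val z m * monom_val z n"
  by (simp add: monom_val_def lookup_add power_add prod.distrib)

lemma ev_mult [simp]: "ev z (f * g) = ev z f * ev z g"
proof (induction f rule: poly_mapping_single_induct)
  case (single m r)
  show ?case
    by (induction g rule: poly_mapping_single_induct)
       (simp_all add: mult_single ev_single monom_val_add distrib_left)
qed (simp add: distrib_right)

lemma ev_cst [simp]: "ev z (cst r) = r"
  by (simp add: cst_def ev_single monom_val_def)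

lemma cst_one: "cst 1 = 1"
  by (simp add: cst_def)

lemma ev_one [simp]: "ev z 1 = 1"
  using ev_cst [of z 1] by (simp add: cst_one)

lemma ev_uminus [simp]: "ev z (- f) = - ev z f"
proof -
  have "ev z (- f) + ev z f = ev z (- f + f)"
    by (simp only: ev_add)
  then show ?thesis by (simp add: eq_neg_iff_add_eq_0)
qed

lemma ev_minus [simp]: "ev z (f - g) = ev z f - ev z g"
  using ev_add [of z f "- g"] by simp

lemma ev_power [simp]: "ev z (f ^ n) = ev z f ^ n"
  by (induction n) auto

lemma ev_of_nat [simp]: "ev z (of_nat n) = of_nat n"
  by (induction n) auto

lemma ev_numeral [simp]: "ev z (numeral n) = numeral n"
  using ev_of_nat [of z "numeral n"] by simp

lemma ev_ind [simp]: "ev z (ind v) = z v"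
proof -
  have "(\<Prod>w\<in>UNIV. z w ^ Poly_Mapping.lookup (Poly_Mapping.single v (Suc 0)) w)
      = (\<Prod>w\<in>{v}. z w ^ Poly_Mapping.lookup (Poly_Mapping.single v (Suc 0)) w)"
    by (intro prod.mono_neutral_right) (auto simp: lookup_single when_def)
  then show ?thesis
    by (simp add: ind_def ev_single monom_val_def)
qed

lemma digits_unique:
  fixes N :: nat
  assumes "a + N * b = a' + N * b'" "a < N" "a' < N"
  shows "a = a' \<and> b = b'"
proof -
  have "(a + N * b) mod N = a" "(a + N * b) div N = b"
    using assms(2) by auto
  moreover have "(a' + N * b') mod N = a'" "(a' + N * b') div N = b'"
    using assms(3) by auto
  ultimately show ?thesis using assms(1) by metis
qed

fun indet_no :: "indet \<Rightarrow> nat" where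
  "indet_no X = 0" | "indet_no A = 1" | "indet_no B = 2" | "indet_no C = 3"
| "indet_no (U i) = (if i = 1 then 4 else if i = 2 then 5 else if i = 3 then 6 else 7)"

text \<open>Kronecker substitution: for large \<open>N\<close>, putting \<open>s^(N^k)\<close> for the \<open>k\<close>-th indeterminate
  sends distinct monomials of \<open>f\<close> to distinct powers of \<open>s\<close>.\<close>

lemma ev_eq_0_imp_eq_0:
  assumes vanish: "\<And>z. (\<And>v. z v \<noteq> 0) \<Longrightarrow> ev z f = 0"
  shows "f = 0"
proof (rule ccontr)
  assume "f \<noteq> 0"
  then obtain m0 where m0: "m0 \<in> Poly_Mapping.keys f"
    by (metis keys_eq_empty ex_in_conv)
  define N where "N = Suc (Max ((\<lambda>(m, v). Poly_Mapping.lookup m v) ` (Poly_Mapping.keys f \<times> UNIV)))"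
  have less_N: "Poly_Mapping.lookup m v < N" if "m \<in> Poly_Mapping.keys f" for m v
    unfolding N_def less_Suc_eq_le using that by (intro Max_ge) force+
  define code where "code m = (\<Sum>v\<in>UNIV. N ^ indet_no v * Poly_Mapping.lookup m v)"
    for m :: "indet \<Rightarrow>\<^sub>0 nat"
  let ?l = "Poly_Mapping.lookup"
  \<comment> \<open>Horner form of the base-\<open>N\<close> expansion, so that
    \<open>digits_unique\<close> peels off one exponent at a time.\<close>
  have code: "code m = ?l m X + N * (?l m A + N * (?l m B + N * (?l m C + N * (?l m (U 1)
      + N * (?l m (U 2) + N * (?l m (U 3) + N * ?l m (U 4)))))))" for m
    unfolding code_def UNIV_indet by (simp add: algebra_simps power_numeral_reduce)
  have inj: "m = m'" if "m \<in> Poly_Mapping.keys f" "m' \<in> Poly_Mapping.keys f" "code m = code m'"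
    for m m'
  proof (rule poly_mapping_eqI)
    fix v
    note d = digits_unique [OF _ less_N [OF that(1)] less_N [OF that(2)]]
    note d1 = d [OF that(3) [unfolded code]]
    note d2 = d [OF conjunct2 [OF d1]]
    note d3 = d [OF conjunct2 [OF d2]]
    note d4 = d [OF conjunct2 [OF d3]]
    note d5 = d [OF conjunct2 [OF d4]]
    note d6 = d [OF conjunct2 [OF d5]]
    note d7 = d [OF conjunct2 [OF d6]]
    have "v \<in> {U 1, U 2, U 3, U 4, X, A, B, C}" using UNIV_indet by blast
    with d1 d2 d3 d4 d5 d6 d7 show "?l m v = ?l m' v" by blast
  qed
  define q where "q = (\<Sum>m\<in>Poly_Mapping.keys f. monom (?l f m) (code m))"
  have "coeff q (code m0) = (\<Sum>m\<in>Poly_Mapping.keys f. if m = m0 then ?l f m else 0)"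
    unfolding q_def coeff_sum coeff_monom using inj m0 by (intro sum.cong) auto
  also have "\<dots> \<noteq> 0" using m0 by (simp add: in_keys_iff)
  finally have "q \<noteq> 0" by auto
  then have "finite {s. poly q s = 0}" by (rule poly_roots_finite)
  \<comment> \<open>Zero is avoided as well, because \<open>vanish\<close> speaks only of points
    with nonzero coordinates.\<close>
  then have "finite (insert 0 {s. poly q s = 0})" by simp
  then obtain s where s: "s \<noteq> 0" "poly q s \<noteq> 0"
    using ex_new_if_finite [OF infinite_UNIV_char_0] by blast
  have "poly q s = ev (\<lambda>v. s ^ (N ^ indet_no v)) f"
    unfolding q_def ev_def monom_val_def code_def
    by (simp add: poly_sum poly_monom power_sum power_mult)
  also have "\<dots> = 0" using s(1) by (intro vanish) auto
  finally show False using s(2) by simp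
qed

lemma poly8_eqI: "(\<And>z. ev z f = ev z g) \<Longrightarrow> f = g"
  using ev_eq_0_imp_eq_0 [of "f - g"] by simp

subsection \<open>Polynomial functions of one variable\<close>

text \<open>A predicate on functions instead of an explicit polynomial: closure rules then show that
  a long evaluated expression is polynomial in a parameter without computing its
  coefficients.\<close>

definition polyfun :: "(complex \<Rightarrow> complex) \<Rightarrow> bool"
  where "polyfun h \<longleftrightarrow> (\<exists>r. \<forall>s. h s = poly r s)"

lemma polyfun_intros [intro]:
  "polyfun (\<lambda>s. k)" "polyfun (\<lambda>s. s)"
  "polyfun g \<Longrightarrow> polyfun h \<Longrightarrow> polyfun (\<lambda>s. g s + h s)"
  "polyfun g \<Longrightarrow> polyfun h \<Longrightarrow> polyfun (\<lambda>s. g s * h s)"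
  "polyfun h \<Longrightarrow> polyfun (\<lambda>s. - h s)"
  "polyfun g \<Longrightarrow> polyfun h \<Longrightarrow> polyfun (\<lambda>s. g s - h s)"
  "polyfun h \<Longrightarrow> polyfun (\<lambda>s. h s ^ n)"
proof -
  show "polyfun (\<lambda>s. k)" "polyfun (\<lambda>s. s)"
    unfolding polyfun_def by (auto intro: exI [of _ "[:k:]"] exI [of _ "[:0, 1:]"])
  show "polyfun (\<lambda>s. g s + h s)" if "polyfun g" "polyfun h"
    using that unfolding polyfun_def by (metis poly_add)
  show "polyfun (\<lambda>s. g s * h s)" if "polyfun g" "polyfun h"
    using that unfolding polyfun_def by (metis poly_mult)
  show "polyfun (\<lambda>s. g s - h s)" if "polyfun g" "polyfun h"
    using that unfolding polyfun_def by (metis poly_diff)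
  show "polyfun (\<lambda>s. - h s)" if "polyfun h"
    using that unfolding polyfun_def by (metis poly_minus)
  show "polyfun (\<lambda>s. h s ^ n)" if "polyfun h"
    using that unfolding polyfun_def by (metis poly_power)
qed

lemma polyfun_divide: "polyfun h \<Longrightarrow> polyfun (\<lambda>s. h s / k)"
  using polyfun_intros(4) [OF _ polyfun_intros(1), of h "1 / k"] by simp

lemma polyfun_sum: "(\<And>i. i \<in> S \<Longrightarrow> polyfun (h i)) \<Longrightarrow> polyfun (\<lambda>s. \<Sum>i\<in>S. h i s)"
  by (induction S rule: infinite_finite_induct) auto

lemma polyfun_prod: "(\<And>i. i \<in> S \<Longrightarrow> polyfun (h i)) \<Longrightarrow> polyfun (\<lambda>s. \<Prod>i\<in>S. h i s)"
  by (induction S rule: infinite_finite_induct) auto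

lemma polyfun_ev: "(\<And>v. polyfun (\<lambda>s. z s v)) \<Longrightarrow> polyfun (\<lambda>s. ev (z s) f)"
  unfolding ev_def monom_val_def
  by (intro polyfun_sum polyfun_intros polyfun_prod)

text \<open>The ring of polynomials in one variable is a domain, so a factor with a single nonzero
  value can be cancelled everywhere. This is how genericity conditions are removed.\<close>

lemma polyfun_eq_0:
  assumes g: "polyfun g" and h: "polyfun h" and "\<And>s. g s * h s = 0" and "g s0 \<noteq> 0"
  shows "h s = 0"
proof -
  obtain q r where q: "\<And>s. g s = poly q s" and r: "\<And>s. h s = poly r s"
    using g h unfolding polyfun_def by metis
  have "poly (q * r) = poly 0" using assms(3) by (auto simp: q r)
  then have "q * r = 0" by (simp only: poly_eq_poly_eq_iff)
  with \<open>g s0 \<noteq> 0\<close> have "r = 0" by (auto simp: q)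
  then show ?thesis by (simp add: r)
qed

text \<open>On the line joining \<open>z0\<close> to an arbitrary \<open>z\<close>, the restriction
  of \<open>g\<close> is a nonzero polynomial in one variable, so it can be cancelled.\<close>

lemma ev_vanish_generically:
  assumes "\<And>z. ev z g \<noteq> 0 \<Longrightarrow> ev z f = 0" and "ev z0 g \<noteq> 0"
  shows "f = 0"
proof (rule ev_eq_0_imp_eq_0)
  fix z
  define l where "l = (\<lambda>s v. z0 v + s * (z v - z0 v))"
  have "ev (l 1) f = 0"
  proof (rule polyfun_eq_0 [of "\<lambda>s. ev (l s) g" "\<lambda>s. ev (l s) f" 0 1])
    show "polyfun (\<lambda>s. ev (l s) g)" "polyfun (\<lambda>s. ev (l s) f)"
      unfolding l_def by (intro polyfun_ev polyfun_intros)+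
    show "ev (l s) g * ev (l s) f = 0" for s using assms(1) by auto
    show "ev (l 0) g \<noteq> 0" using assms(2) by (simp add: l_def)
  qed
  then show "ev z f = 0" by (simp add: l_def)
qed

section \<open>Subrings, grading, derivatives\<close>

lemma polys_in_zero [intro]: "0 \<in> polys_in V"
  by (simp add: polys_in_def)

lemma polys_in_add [intro]: "f \<in> polys_in V \<Longrightarrow> g \<in> polys_in V \<Longrightarrow> f + g \<in> polys_in V"
  using keys_add [of f g] unfolding polys_in_def by blast

lemma polys_in_uminus [intro]: "f \<in> polys_in V \<Longrightarrow> - f \<in> polys_in V"
  by (simp add: polys_in_def)

lemma polys_in_minus [intro]: "f \<in> polys_in V \<Longrightarrow> g \<in> polys_in V \<Longrightarrow> f - g \<in> polys_in V"
  using polys_in_add [of f V "- g"] by auto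

lemma polys_in_mult [intro]:
  assumes "f \<in> polys_in V" "g \<in> polys_in V"
  shows "f * g \<in> polys_in V"
  unfolding polys_in_def
proof safe
  fix m v assume "m \<in> Poly_Mapping.keys (f * g)" "v \<in> Poly_Mapping.keys m"
  then obtain k l where "k \<in> Poly_Mapping.keys f" "l \<in> Poly_Mapping.keys g"
    "v \<in> Poly_Mapping.keys (k + l)"
    using keys_mult [of f g] by blast
  with keys_add [of k l] assms show "v \<in> V" unfolding polys_in_def by blast
qed

lemma polys_in_cst [intro]: "cst r \<in> polys_in V"
  by (simp add: polys_in_def cst_def)

lemma polys_in_one [intro]: "1 \<in> polys_in V"
  using polys_in_cst [of 1 V] by (simp add: cst_one)

lemma polys_in_power [intro]: "f \<in> polys_in V \<Longrightarrow> f ^ n \<in> polys_in V"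
  by (induction n) auto

lemma numeral_eq_cst: "(numeral n :: poly8) = cst (numeral n)"
  by (simp add: cst_def)

lemma polys_in_numeral [intro]: "numeral n \<in> polys_in V"
  by (auto simp: numeral_eq_cst)

lemma polys_in_ind [intro]: "v \<in> V \<Longrightarrow> ind v \<in> polys_in V"
  by (simp add: polys_in_def ind_def)

lemma polys_in_mono: "V \<subseteq> V' \<Longrightarrow> f \<in> polys_in V \<Longrightarrow> f \<in> polys_in V'"
  by (auto simp: polys_in_def)

lemma ev_cong_polys_in:
  assumes "f \<in> polys_in V" "\<And>v. v \<in> V \<Longrightarrow> z v = z' v"
  shows "ev z f = ev z' f"
  unfolding ev_def monom_val_def
proof (intro sum.cong refl arg_cong2 [where f = "(*)"] prod.cong)
  fix m v assume "m \<in> Poly_Mapping.keys f"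
  then have "v \<in> V" if "Poly_Mapping.lookup m v \<noteq> 0"
    using assms(1) that unfolding polys_in_def by (auto simp: in_keys_iff subset_iff)
  then show "z v ^ Poly_Mapping.lookup m v = z' v ^ Poly_Mapping.lookup m v"
    using assms(2) by (cases "Poly_Mapping.lookup m v = 0") auto
qed

section \<open>Weighted degree and homogeneity\<close>

lemma mono_deg_eq: "mono_deg m = (\<Sum>v\<in>UNIV. int (Poly_Mapping.lookup m v) * wt v)"
  unfolding mono_deg_def by (intro sum.mono_neutral_left) (auto simp: in_keys_iff)

lemma mono_deg_add: "mono_deg (m + n) = mono_deg m + mono_deg n"
  by (simp add: mono_deg_eq lookup_add distrib_right sum.distrib)

lemma homogeneous_zero: "homogeneous d 0"
  by (simp add: homogeneous_def)

lemma homogeneous_add: "homogeneous d f \<Longrightarrow> homogeneous d g \<Longrightarrow> homogeneous d (f + g)"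
  using keys_add [of f g] unfolding homogeneous_def by blast

lemma homogeneous_uminus: "homogeneous d f \<Longrightarrow> homogeneous d (- f)"
  by (simp add: homogeneous_def)

lemma homogeneous_minus: "homogeneous d f \<Longrightarrow> homogeneous d g \<Longrightarrow> homogeneous d (f - g)"
  using homogeneous_add [of d f "- g"] by (simp add: homogeneous_uminus)

lemma homogeneous_mult: "homogeneous d f \<Longrightarrow> homogeneous e g \<Longrightarrow> homogeneous (d + e) (f * g)"
  using keys_mult [of f g] unfolding homogeneous_def by (fastforce simp: mono_deg_add)

lemma homogeneous_cst: "d = 0 \<Longrightarrow> homogeneous d (cst r)"
  by (simp add: homogeneous_def cst_def mono_deg_def)

lemma homogeneous_one: "d = 0 \<Longrightarrow> homogeneous d 1"
  using homogeneous_cst [of d 1] by (simp add: cst_one)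

lemma homogeneous_numeral: "d = 0 \<Longrightarrow> homogeneous d (numeral n)"
  by (simp add: homogeneous_cst numeral_eq_cst)

lemma homogeneous_ind: "d = wt v \<Longrightarrow> homogeneous d (ind v)"
  by (simp add: homogeneous_def ind_def mono_deg_def)

lemma homogeneous_power: "homogeneous d f \<Longrightarrow> homogeneous (int n * d) (f ^ n)"
proof (induction n)
  case (Suc n)
  from homogeneous_mult [OF Suc.prems Suc.IH [OF Suc.prems]] show ?case
    by (simp add: algebra_simps)
qed (simp add: homogeneous_one)

lemma homogeneous_ind_power: "d = int n * wt v \<Longrightarrow> homogeneous d (ind v ^ n)"
  by (simp add: homogeneous_ind homogeneous_power)

text \<open>The conclusion has an arbitrary degree and the premise the remaining one, so that
  applying such rules backwards strips a monomial factor by factor and ends in integer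
  arithmetic.\<close>

lemma homogeneous_mult_ind: "homogeneous (d - wt v) f \<Longrightarrow> homogeneous d (f * ind v)"
  using homogeneous_mult [of "d - wt v" f "wt v" "ind v"] by (simp add: homogeneous_ind)

lemma homogeneous_ind_mult: "homogeneous (d - wt v) f \<Longrightarrow> homogeneous d (ind v * f)"
  using homogeneous_mult_ind by (simp add: mult.commute)

lemma homogeneous_mult_ind_power:
  "homogeneous (d - int n * wt v) f \<Longrightarrow> homogeneous d (f * ind v ^ n)"
  using homogeneous_mult [of "d - int n * wt v" f "int n * wt v" "ind v ^ n"]
  by (simp add: homogeneous_ind_power)

lemma homogeneous_cst_mult: "homogeneous d f \<Longrightarrow> homogeneous d (cst r * f)"
  using homogeneous_mult [of 0 "cst r"] by (simp add: homogeneous_cst)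

lemmas homogeneous_intros = homogeneous_add homogeneous_minus homogeneous_uminus
  homogeneous_mult_ind homogeneous_mult_ind_power homogeneous_ind_mult homogeneous_ind
  homogeneous_ind_power homogeneous_cst homogeneous_numeral homogeneous_one homogeneous_zero
  homogeneous_cst_mult

lemma vector_4 [simp]:
  "(vector [a, b, c, d] :: 'a::zero ^ 4) $ 1 = a"
  "(vector [a, b, c, d] :: 'a ^ 4) $ 2 = b"
  "(vector [a, b, c, d] :: 'a ^ 4) $ 3 = c"
  "(vector [a, b, c, d] :: 'a ^ 4) $ 4 = d"
  by (simp_all add: vector_def)

section \<open>Formal partial derivatives\<close>

lemma pd_superset:
  assumes "finite S" "Poly_Mapping.keys f \<subseteq> S"
  shows "pd v f = (\<Sum>m\<in>S. Poly_Mapping.single (m - Poly_Mapping.single v 1)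
    (of_nat (Poly_Mapping.lookup m v) * Poly_Mapping.lookup f m))"
  unfolding pd_def using assms
  by (intro sum.mono_neutral_left) (auto simp: in_keys_iff)

lemma pd_add [simp]: "pd v (f + g) = pd v f + pd v g"
proof -
  let ?S = "Poly_Mapping.keys f \<union> Poly_Mapping.keys g"
  show ?thesis
    using keys_add [of f g]
    by (subst (1 2 3) pd_superset [of ?S])
       (auto simp: lookup_add sum.distrib distrib_left single_add)
qed

lemma pd_single: "pd v (Poly_Mapping.single m r)
    = Poly_Mapping.single (m - Poly_Mapping.single v 1) (of_nat (Poly_Mapping.lookup m v) * r)"
  by (subst pd_superset [of "{m}"]) auto

lemma pd_mult_single:
  "pd v (Poly_Mapping.single m r * Poly_Mapping.single n s)
    = pd v (Poly_Mapping.single m r) * Poly_Mapping.single n s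
      + Poly_Mapping.single m r * pd v (Poly_Mapping.single n s)"
proof -
  let ?e = "Poly_Mapping.single v (1::nat)"
  \<comment> \<open>Truncated subtraction commutes with adding \<open>n\<close> only if
    \<open>v\<close> occurs in \<open>m\<close>; otherwise both coefficients are 0.\<close>
  have l: "Poly_Mapping.single (m + n - ?e) (of_nat (Poly_Mapping.lookup m v) * (r * s))
      = Poly_Mapping.single (m - ?e + n) (of_nat (Poly_Mapping.lookup m v) * (r * s))"
    for m n :: "indet \<Rightarrow>\<^sub>0 nat" and r s :: complex
  proof (cases "Poly_Mapping.lookup m v = 0")
    case False
    then have "m + n - ?e = m - ?e + n"
      by (intro poly_mapping_eqI) (auto simp: lookup_add lookup_minus lookup_single when_def)
    then show ?thesis by simp
  qed simp
  from l [where m = m and n = n and r = r and s = s] l [where m = n and n = m and r = s and s = r] show ?thesis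
    by (simp add: mult_single pd_single lookup_add single_add distrib_right algebra_simps)
qed

lemma pd_mult [simp]: "pd v (f * g) = pd v f * g + f * pd v g"
proof (induction f rule: poly_mapping_single_induct)
  case (single m r)
  show ?case
    by (induction g rule: poly_mapping_single_induct)
       (simp_all only: pd_mult_single pd_add distrib_left, simp)
qed (simp add: algebra_simps)

lemma pd_cst [simp]: "pd v (cst r) = 0"
  by (simp add: cst_def pd_single)

lemma pd_numeral [simp]: "pd v (numeral n) = 0"
  by (simp add: numeral_eq_cst)

lemma pd_one [simp]: "pd v 1 = 0"
  using pd_cst [of v 1] by (simp add: cst_one)

lemma pd_zero [simp]: "pd v 0 = 0"
  by (simp add: pd_def)

lemma pd_uminus [simp]: "pd v (- f) = - pd v f"
  using pd_add [of v f "- f"] by (simp add: eq_neg_iff_add_eq_0 add.commute)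

lemma pd_minus [simp]: "pd v (f - g) = pd v f - pd v g"
  using pd_add [of v f "- g"] by simp

lemma pd_power: "pd v (f ^ n) = of_nat n * f ^ (n - 1) * pd v f"
proof (induction n)
  case (Suc n)
  then show ?case by (cases n) (simp_all add: algebra_simps)
qed simp

lemma pd_ind: "pd v (ind w) = (if v = w then 1 else 0)"
  by (simp add: ind_def pd_single lookup_single when_def)

section \<open>The quotient ring\<close>

lemma ring_R: "ring (R :: poly8 ring)"
  by (intro cring.axioms cring_class)

lemma ideal_I: "ideal I R"
  unfolding I_def by (intro ring.genideal_ideal ring_R) (auto simp: carrier_class)

lemma cls_eq_iff: "cls f = cls g \<longleftrightarrow> f - g \<in> I"
  using ring.quotient_eq_iff_same_a_r_cos [OF ring_R ideal_I, of f g]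
  by (simp add: carrier_class minus_class cls_def)

lemma I_zero: "0 \<in> I"
  using cls_eq_iff [of 0 0] by simp

lemma I_add: "f \<in> I \<Longrightarrow> g \<in> I \<Longrightarrow> f + g \<in> I"
  using additive_subgroup.a_closed [OF ideal.axioms(1) [OF ideal_I]] by (simp add: plus_class)

lemma I_mult: "f \<in> I \<Longrightarrow> g * f \<in> I"
  using ideal.I_l_closed [OF ideal_I, of f g] by (simp add: times_class carrier_class)

lemma I_uminus: "f \<in> I \<Longrightarrow> - f \<in> I"
  using I_mult [of f "- 1"] by simp

lemma I_minus: "f \<in> I \<Longrightarrow> g \<in> I \<Longrightarrow> f - g \<in> I"
  using I_add [OF _ I_uminus] by fastforce

lemma I_generators:
  "cv^2 - q^2 - 4 * p^3 \<in> I" "av * bv + p^3 \<in> I"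
  "av^2 - cst (1/2) * (q - cv) * bv \<in> I" "bv^2 - cst (1/2) * (q + cv) * av \<in> I"
  unfolding I_def by (rule set_mp [OF ring.genideal_self [OF ring_R]], simp add: carrier_class, simp)+

lemma cls_add: "cls f \<oplus>\<^bsub>quot\<^esub> cls g = cls (f + g)"
  using ideal.a_rcos_sum [OF ideal_I, of f g]
  by (simp add: FactRing_def cls_def carrier_class plus_class)

lemma cls_mult: "cls f \<otimes>\<^bsub>quot\<^esub> cls g = cls (f * g)"
  using ideal.rcoset_mult_add [OF ideal_I, of f g]
  by (simp add: FactRing_def cls_def carrier_class times_class)

text \<open>Evaluation at a common zero of the generators has as kernel an ideal that contains them,
  hence contains \<open>I\<close>.\<close>

lemma ev_I:
  assumes "f \<in> I" and "ev z cv ^ 2 = ev z q ^ 2 + 4 * ev z p ^ 3" "ev z av * ev z bv = - (ev z p ^ 3)"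
    "ev z av ^ 2 = (ev z q - ev z cv) * ev z bv / 2" "ev z bv ^ 2 = (ev z q + ev z cv) * ev z av / 2"
  shows "ev z f = 0"
proof -
  let ?J = "{f. ev z f = 0}"
  have "subgroup ?J (add_monoid (R :: poly8 ring))"
  proof
    show "?J \<subseteq> carrier (add_monoid R)" by (auto simp: carrier_class)
    show "inv\<^bsub>add_monoid R\<^esub> f \<in> ?J" if "f \<in> ?J" for f
      using that uminus_class [of f] by (simp add: a_inv_def)
  qed (simp_all add: plus_class zero_class)
  then have "ideal ?J R"
    by (intro idealI ring_R) (auto simp: times_class)
  moreover have "{cv^2 - q^2 - 4 * p^3, av * bv + p^3, av^2 - cst (1/2) * (q - cv) * bv,
      bv^2 - cst (1/2) * (q + cv) * av} \<subseteq> ?J"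
    using assms(2-) by simp
  ultimately have "I \<subseteq> ?J"
    unfolding I_def by (rule ring.genideal_minimal [OF ring_R])
  with assms(1) show ?thesis by blast
qed

section \<open>The curve as a cubic in \<open>W\<close>\<close>

text \<open>\<open>B1\<close>, \<open>B2\<close>, \<open>B3\<close> are \<open>b1\<close>, \<open>3 b2\<close>, \<open>108 b3\<close> as functions of \<open>x, u\<^sub>1, \<dots>, u\<^sub>4\<close>, and \<open>G2\<close>, \<open>G1\<close>,
  \<open>G0\<close> are their partial derivatives; the factors make all coefficients integers. With
  \<open>G = b3 + b2 W + b1 W^2 - 8 W^3\<close>, \<open>cubic t w\<close> is \<open>108 t^3 G\<close> and \<open>cubic_deriv v t w\<close> is \<open>108 t^2 (\<partial>G/\<partial>v)\<close>, both at
  \<open>W = w/t\<close>.\<close>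

definition B1 :: "'a \<Rightarrow> 'a \<Rightarrow> 'a \<Rightarrow> 'a \<Rightarrow> 'a \<Rightarrow> 'a::comm_ring_1"
  where "B1 x k l m n =
    - 636 * x^9 - 300 * x^7 * k - 48 * x^5 * k^2 - 5 * x^3 * l + 2 * x * m"

definition B2 :: "'a \<Rightarrow> 'a \<Rightarrow> 'a \<Rightarrow> 'a \<Rightarrow> 'a \<Rightarrow> 'a::comm_ring_1"
  where "B2 x k l m n =
    - 504 * x^18 - 1044 * x^16 * k - 828 * x^14 * k^2 - 348 * x^12 * k^3 + 42 * x^12 * l - 60 * x^10 * k^4
    - 24 * x^10 * k * l - 276 * x^10 * m - 18 * x^8 * k^2 * l - 126 * x^8 * k * m - 10 * x^6 * k^2 * m
    - 2 * x^6 * l^2 - 12 * x^6 * n - 2 * x^4 * k * n + x^4 * l * m"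

definition B3 :: "'a \<Rightarrow> 'a \<Rightarrow> 'a \<Rightarrow> 'a \<Rightarrow> 'a \<Rightarrow> 'a::comm_ring_1"
  where "B3 x k l m n =
    108 * x^27 + 648 * x^25 * k + 1620 * x^23 * k^2 + 2160 * x^21 * k^3 + 108 * x^21 * l + 1620 * x^19 * k^4
    + 432 * x^19 * k * l + 540 * x^19 * m + 648 * x^17 * k^5 + 648 * x^17 * k^2 * l + 1296 * x^17 * k * m
    + 108 * x^15 * k^6 + 432 * x^15 * k^3 * l + 936 * x^15 * k^2 * m + 36 * x^15 * l^2 + 540 * x^15 * n
    + 108 * x^13 * k^4 * l + 144 * x^13 * k^3 * m + 72 * x^13 * k * l^2 + 684 * x^13 * k * n
    + 144 * x^13 * l * m - 36 * x^11 * k^4 * m + 36 * x^11 * k^2 * l^2 + 324 * x^11 * k^2 * n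
    - 405 * x^11 * m^2 + 52 * x^9 * k^3 * n - 48 * x^9 * k^2 * l * m - 234 * x^9 * k * m^2 + 4 * x^9 * l^3
    + 36 * x^9 * l * n - 21 * x^7 * k^2 * m^2 + 12 * x^7 * k * l * n - 12 * x^7 * l^2 * m - 54 * x^7 * m * n
    - 18 * x^5 * k * m * n + 9 * x^5 * l * m^2 - 2 * x^3 * m^3 - x^3 * n^2"

fun G0 :: "indet \<Rightarrow> 'a \<Rightarrow> 'a \<Rightarrow> 'a \<Rightarrow> 'a \<Rightarrow> 'a \<Rightarrow> 'a::comm_ring_1" where
  "G0 X x k l m n =
    2916 * x^26 + 16200 * x^24 * k + 37260 * x^22 * k^2 + 45360 * x^20 * k^3 + 2268 * x^20 * l
    + 30780 * x^18 * k^4 + 8208 * x^18 * k * l + 10260 * x^18 * m + 11016 * x^16 * k^5 + 11016 * x^16 * k^2 * l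
    + 22032 * x^16 * k * m + 1620 * x^14 * k^6 + 6480 * x^14 * k^3 * l + 14040 * x^14 * k^2 * m
    + 540 * x^14 * l^2 + 8100 * x^14 * n + 1404 * x^12 * k^4 * l + 1872 * x^12 * k^3 * m + 936 * x^12 * k * l^2
    + 8892 * x^12 * k * n + 1872 * x^12 * l * m - 396 * x^10 * k^4 * m + 396 * x^10 * k^2 * l^2
    + 3564 * x^10 * k^2 * n - 4455 * x^10 * m^2 + 468 * x^8 * k^3 * n - 432 * x^8 * k^2 * l * m
    - 2106 * x^8 * k * m^2 + 36 * x^8 * l^3 + 324 * x^8 * l * n - 147 * x^6 * k^2 * m^2 + 84 * x^6 * k * l * n
    - 84 * x^6 * l^2 * m - 378 * x^6 * m * n - 90 * x^4 * k * m * n + 45 * x^4 * l * m^2 - 6 * x^2 * m^3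
    - 3 * x^2 * n^2"
| "G0 (U i) x k l m n =
   (if i = 1 then
      648 * x^25 + 3240 * x^23 * k + 6480 * x^21 * k^2 + 6480 * x^19 * k^3 + 432 * x^19 * l
      + 3240 * x^17 * k^4 + 1296 * x^17 * k * l + 1296 * x^17 * m + 648 * x^15 * k^5 + 1296 * x^15 * k^2 * l
      + 1872 * x^15 * k * m + 432 * x^13 * k^3 * l + 432 * x^13 * k^2 * m + 72 * x^13 * l^2
      + 684 * x^13 * n - 144 * x^11 * k^3 * m + 72 * x^11 * k * l^2 + 648 * x^11 * k * n + 156 * x^9 * k^2 * n
      - 96 * x^9 * k * l * m - 234 * x^9 * m^2 - 42 * x^7 * k * m^2 + 12 * x^7 * l * n - 18 * x^5 * m * n
    else if i = 2 then
      108 * x^21 + 432 * x^19 * k + 648 * x^17 * k^2 + 432 * x^15 * k^3 + 72 * x^15 * l + 108 * x^13 * k^4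
      + 144 * x^13 * k * l + 144 * x^13 * m + 72 * x^11 * k^2 * l - 48 * x^9 * k^2 * m + 12 * x^9 * l^2
      + 36 * x^9 * n + 12 * x^7 * k * n - 24 * x^7 * l * m + 9 * x^5 * m^2
    else if i = 3 then
      540 * x^19 + 1296 * x^17 * k + 936 * x^15 * k^2 + 144 * x^13 * k^3 + 144 * x^13 * l - 36 * x^11 * k^4
      - 810 * x^11 * m - 48 * x^9 * k^2 * l - 468 * x^9 * k * m - 42 * x^7 * k^2 * m - 12 * x^7 * l^2
      - 54 * x^7 * n - 18 * x^5 * k * n + 18 * x^5 * l * m - 6 * x^3 * m^2
    else
      540 * x^15 + 684 * x^13 * k + 324 * x^11 * k^2 + 52 * x^9 * k^3 + 36 * x^9 * l + 12 * x^7 * k * l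
      - 54 * x^7 * m - 18 * x^5 * k * m - 2 * x^3 * n)"
| "G0 _ x k l m n = 0"

fun G1 :: "indet \<Rightarrow> 'a \<Rightarrow> 'a \<Rightarrow> 'a \<Rightarrow> 'a \<Rightarrow> 'a \<Rightarrow> 'a::comm_ring_1" where
  "G1 X x k l m n =
    - 9072 * x^17 - 16704 * x^15 * k - 11592 * x^13 * k^2 - 4176 * x^11 * k^3 + 504 * x^11 * l
    - 600 * x^9 * k^4 - 240 * x^9 * k * l - 2760 * x^9 * m - 144 * x^7 * k^2 * l - 1008 * x^7 * k * m
    - 60 * x^5 * k^2 * m - 12 * x^5 * l^2 - 72 * x^5 * n - 8 * x^3 * k * n + 4 * x^3 * l * m"
| "G1 (U i) x k l m n =
   (if i = 1 then
      - 1044 * x^16 - 1656 * x^14 * k - 1044 * x^12 * k^2 - 240 * x^10 * k^3 - 24 * x^10 * l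
      - 36 * x^8 * k * l - 126 * x^8 * m - 20 * x^6 * k * m - 2 * x^4 * n
    else if i = 2 then
      42 * x^12 - 24 * x^10 * k - 18 * x^8 * k^2 - 4 * x^6 * l + x^4 * m
    else if i = 3 then
      - 276 * x^10 - 126 * x^8 * k - 10 * x^6 * k^2 + x^4 * l
    else
      - 12 * x^6 - 2 * x^4 * k)"
| "G1 _ x k l m n = 0"

fun G2 :: "indet \<Rightarrow> 'a \<Rightarrow> 'a \<Rightarrow> 'a \<Rightarrow> 'a \<Rightarrow> 'a \<Rightarrow> 'a::comm_ring_1" where
  "G2 X x k l m n =
    - 5724 * x^8 - 2100 * x^6 * k - 240 * x^4 * k^2 - 15 * x^2 * l + 2 * m"
| "G2 (U i) x k l m n =
   (if i = 1 then
      - 300 * x^7 - 96 * x^5 * k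
    else if i = 2 then
      - 5 * x^3
    else if i = 3 then
      2 * x
    else
      0)"
| "G2 _ x k l m n = 0"

lemmas B_defs = B1_def B2_def B3_def

definition cubic :: "'a \<Rightarrow> 'a \<Rightarrow> 'a \<Rightarrow> 'a \<Rightarrow> 'a \<Rightarrow> 'a \<Rightarrow> 'a \<Rightarrow> 'a::comm_ring_1"
  where "cubic t w x k l m n = t^3 * B3 x k l m n + 36 * t^2 * w * B2 x k l m n
    + 108 * t * w^2 * B1 x k l m n - 864 * w^3"

definition cubic_deriv :: "indet \<Rightarrow> 'a \<Rightarrow> 'a \<Rightarrow> 'a \<Rightarrow> 'a \<Rightarrow> 'a \<Rightarrow> 'a \<Rightarrow> 'a \<Rightarrow> 'a::comm_ring_1"
  where "cubic_deriv v t w x k l m n = t^2 * G0 v x k l m n + 36 * t * w * G1 v x k l m n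
    + 108 * w^2 * G2 v x k l m n"

lemma four_eq_simps:
  "((1::4) = 1) = True" "((2::4) = 2) = True" "((3::4) = 3) = True"
  "((2::4) = 1) = False" "((3::4) = 1) = False" "((3::4) = 2) = False"
  "((4::4) = 1) = False" "((4::4) = 2) = False" "((4::4) = 3) = False"
  by simp_all

lemmas cubic_unfold = cubic_deriv_def cubic_def B_defs G0.simps G1.simps G2.simps
  four_eq_simps if_True if_False

lemma b_eq:
  "b1 = B1 xv u1 u2 u3 u4"
  "b2 = cst (1/3) * B2 xv u1 u2 u3 u4"
  "b3 = cst (1/108) * B3 xv u1 u2 u3 u4"
  by (rule poly8_eqI, simp add: b1_def b2_def b3_def B_defs algebra_simps add_divide_distrib
      diff_divide_distrib)+

lemma pd_B:
  assumes "v \<in> {X, U 1, U 2, U 3, U 4}"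
  shows "pd v (B1 xv u1 u2 u3 u4) = G2 v xv u1 u2 u3 u4"
    and "pd v (B2 xv u1 u2 u3 u4) = G1 v xv u1 u2 u3 u4"
    and "pd v (B3 xv u1 u2 u3 u4) = G0 v xv u1 u2 u3 u4"
  using assms unfolding B_defs by (auto simp: pd_power pd_ind)

lemma pd_b:
  assumes "v \<in> {X, U 1, U 2, U 3, U 4}"
  shows "pd v b1 = G2 v xv u1 u2 u3 u4"
    and "pd v b2 = cst (1/3) * G1 v xv u1 u2 u3 u4"
    and "pd v b3 = cst (1/108) * G0 v xv u1 u2 u3 u4"
  by (simp_all add: b_eq pd_B [OF assms])

text \<open>Modulo \<open>I\<close>, \<open>nf h0 h1 h2\<close> is \<open>(a - b) p^2 (h0 + h1 W + h2 W^2)\<close> for the root \<open>W = half_w / p\<close> of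
  the cubic, written without denominators in the form required of \<open>Q\<close>.\<close>

definition half_w :: poly8
  where "half_w = cst (1/2) * (cst (1/12) * p * b1 - (av + bv))"

definition nf_diff :: "poly8 \<Rightarrow> poly8 \<Rightarrow> poly8 \<Rightarrow> poly8"
  where "nf_diff h0 h1 h2 = p^2 * h0 + cst (1/2) * p * h1 * (cst (1/12) * p * b1 + cst (1/2) * q)
    + cst (1/4) * h2 * (cst (1/144) * p^2 * b1^2 + cst (1/12) * p * q * b1 - p^3)"

definition nf_sum :: "poly8 \<Rightarrow> poly8 \<Rightarrow> poly8"
  where "nf_sum h1 h2 = cst (1/4) * p * h1 + cst (1/48) * p * b1 * h2"

definition nf :: "poly8 \<Rightarrow> poly8 \<Rightarrow> poly8 \<Rightarrow> poly8"
  where "nf h0 h1 h2 = (av - bv) * nf_diff h0 h1 h2 + cv * (av + bv) * nf_sum h1 h2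
    - cst (1/4) * av * bv * cv * h2"

text \<open>This and \<open>b3_conv\<close> solve the definitions of \<open>p\<close> and
  \<open>q\<close> for \<open>b2\<close> and \<open>b3\<close>, so that later identities can be
  checked with \<open>b1\<close>, \<open>p\<close>, \<open>q\<close> as independent
  quantities.\<close>

lemma b2_conv: "b2 = - 6 * p - cst (1/24) * b1^2"
  by (rule poly8_eqI) (simp add: p_def)

lemma b3_conv: "b3 = q - cst (1/864) * b1^3 - cst (1/24) * b1 * b2"
  by (rule poly8_eqI) (simp add: q_def field_simps)

lemma pd_p: "pd v p = - cst (1/6) * pd v b2 - cst (1/72) * b1 * pd v b1"
  by (rule poly8_eqI) (simp add: p_def pd_power)

lemma pd_q: "pd v q = cst (1/27) * (cst (3/32) * b1^2 * pd v b1
    + cst (9/8) * (b1 * pd v b2 + b2 * pd v b1) + 27 * pd v b3)"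
  by (rule poly8_eqI) (simp add: q_def pd_power algebra_simps)

text \<open>Implicit differentiation gives \<open>G_v / G_W\<close> up to sign for a derivative of
  \<open>W\<close>, and on the curve \<open>a b c = (a - b) p^2 G_W / 6\<close>, which cancels the
  denominator \<open>G_W\<close>. The resulting formula is an exact identity of polynomials, not
  only one modulo \<open>I\<close>.\<close>

lemma F_eq_nf: "F (pd v) = cst (1/6) * nf (pd v b3) (pd v b2) (pd v b1)"
  unfolding F_def nf_def nf_diff_def nf_sum_def pd_p pd_q
  by (subst b2_conv, rule poly8_eqI, simp add: field_simps power2_eq_square power3_eq_cube)

section \<open>Congruence modulo \<open>I\<close>\<close>

definition I_cong :: "poly8 \<Rightarrow> poly8 \<Rightarrow> bool" (infix "\<approx>" 50)
  where "f \<approx> g \<longleftrightarrow> f - g \<in> I"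

lemma I_cong_refl: "f \<approx> f"
  by (simp add: I_cong_def I_zero)

lemma I_cong_sym: "f \<approx> g \<Longrightarrow> g \<approx> f"
  unfolding I_cong_def using I_uminus by fastforce

lemma I_cong_trans [trans]: "f \<approx> g \<Longrightarrow> g \<approx> h \<Longrightarrow> f \<approx> h"
  unfolding I_cong_def using I_add by fastforce

lemma I_cong_add: "f \<approx> f' \<Longrightarrow> g \<approx> g' \<Longrightarrow> f + g \<approx> f' + g'"
  unfolding I_cong_def using I_add by (fastforce simp: add_diff_add)

lemma I_cong_mult:
  assumes "f \<approx> f'" "g \<approx> g'"
  shows "f * g \<approx> f' * g'"
proof -
  have "f * g - f' * g' = g * (f - f') + f' * (g - g')"
    by (simp add: algebra_simps)
  then show ?thesis
    using assms unfolding I_cong_def by (simp add: I_add I_mult)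
qed

lemma I_cong_sum: "(\<And>i. i \<in> S \<Longrightarrow> f i \<approx> g i) \<Longrightarrow> sum f S \<approx> sum g S"
  by (induction S rule: infinite_finite_induct) (auto intro: I_cong_refl I_cong_add)

text \<open>Modulo \<open>I\<close>,
  \<open>(a - b)(a + b) = a^2 - b^2 = - (q (a - b) + c (a + b)) / 2\<close>. Hence multiplying
  \<open>a - b\<close> by powers of \<open>half_w\<close> stays within combinations of
  \<open>a - b\<close>, \<open>c (a + b)\<close> and \<open>a b c\<close>. The displayed identity
  exhibits the difference as a combination of generators.\<close>

lemma nf_cong: "nf h0 h1 h2 \<approx> (av - bv) * (p^2 * h0 + p * half_w * h1 + half_w^2 * h2)"
proof -
  have "nf h0 h1 h2 - (av - bv) * (p^2 * h0 + p * half_w * h1 + half_w^2 * h2)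
    = (cst (1/2) * p * h1 + cst (1/24) * h2 * p * b1 - cst (1/4) * h2 * (av + bv - cst (1/2) * q))
        * ((av^2 - cst (1/2) * (q - cv) * bv) - (bv^2 - cst (1/2) * (q + cv) * av))
      + cst (1/8) * h2 * cv
        * ((av^2 - cst (1/2) * (q - cv) * bv) + (bv^2 - cst (1/2) * (q + cv) * av))
      + cst (1/16) * h2 * (av - bv) * (cv^2 - q^2 - 4 * p^3)"
    by (rule poly8_eqI)
       (simp add: nf_def nf_diff_def nf_sum_def half_w_def field_simps power2_eq_square power3_eq_cube)
  then show ?thesis
    unfolding I_cong_def by (simp only: I_add I_minus I_mult I_generators)
qed

text \<open>Cardano's formula: the substitution \<open>a + b = p (b1/12 - 2 W)\<close> turns the
  cubic into a multiple of \<open>(a + b)^3 + 3 p^3 (a + b) + p^3 q\<close>, and modulo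
  \<open>I\<close> one has \<open>a b = - p^3\<close> and \<open>a^3 + b^3 = q a b\<close>.\<close>

lemma cubic_I: "cubic p half_w xv u1 u2 u3 u4 \<in> I"
proof -
  have "cubic p half_w xv u1 u2 u3 u4
      = 108 * (p^3 * b3 + p^2 * half_w * b2 + p * half_w^2 * b1 - 8 * half_w^3)"
    by (rule poly8_eqI) (simp add: cubic_def b_eq)
  also have "\<dots> = 108 * (av * (av^2 - cst (1/2) * (q - cv) * bv)
      + bv * (bv^2 - cst (1/2) * (q + cv) * av) + (q + 3 * (av + bv)) * (av * bv + p^3))"
    unfolding b3_conv half_w_def
    by (subst (1 2) b2_conv, rule poly8_eqI, simp add: field_simps power2_eq_square power3_eq_cube)
  also have "\<dots> \<in> I"
    by (intro I_add I_mult I_generators)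
  finally show ?thesis .
qed

section \<open>Existence of the multiplication relations\<close>

lemma homogeneous_b:
  "homogeneous 9 b1" "homogeneous 18 b2" "homogeneous 27 b3"
  unfolding b1_def b2_def b3_def by (intro homogeneous_intros; simp)+

lemma homogeneous_mult': "homogeneous d f \<Longrightarrow> homogeneous e g \<Longrightarrow> d + e = k \<Longrightarrow> homogeneous k (f * g)"
  using homogeneous_mult by blast

lemma homogeneous_power': "homogeneous d f \<Longrightarrow> int n * d = k \<Longrightarrow> homogeneous k (f ^ n)"
  using homogeneous_power by blast

lemma homogeneous_p: "homogeneous 18 p"
  unfolding p_def minus_mult_left [symmetric]
  by (intro homogeneous_minus homogeneous_uminus homogeneous_cst_mult homogeneous_b
      homogeneous_power' [OF homogeneous_b(1)]) simp

lemma homogeneous_numeral_mult: "homogeneous d f \<Longrightarrow> homogeneous d (numeral n * f)"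
  by (simp add: numeral_eq_cst homogeneous_cst_mult)

lemma homogeneous_q: "homogeneous 27 q"
  unfolding q_def mult.assoc
  by (auto intro!: homogeneous_add homogeneous_cst_mult homogeneous_numeral_mult
      homogeneous_power' [OF homogeneous_b(1)] homogeneous_mult' [OF homogeneous_b(1,2)]
      homogeneous_b)

lemma Kx_b: "b1 \<in> Kx" "b2 \<in> Kx" "b3 \<in> Kx"
  unfolding Kx_def b1_def b2_def b3_def
  by (intro polys_in_add polys_in_minus polys_in_mult polys_in_power polys_in_uminus polys_in_cst
      polys_in_numeral polys_in_ind; simp)+

lemma Kx_closed:
  "f \<in> Kx \<Longrightarrow> g \<in> Kx \<Longrightarrow> f + g \<in> Kx" "f \<in> Kx \<Longrightarrow> g \<in> Kx \<Longrightarrow> f - g \<in> Kx"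
  "f \<in> Kx \<Longrightarrow> g \<in> Kx \<Longrightarrow> f * g \<in> Kx" "f \<in> Kx \<Longrightarrow> - f \<in> Kx" "f \<in> Kx \<Longrightarrow> f ^ n \<in> Kx"
  "cst r \<in> Kx" "numeral n' \<in> Kx" "0 \<in> Kx"
  unfolding Kx_def by auto

lemma Kx_pq: "p \<in> Kx" "q \<in> Kx"
  unfolding p_def q_def by (intro Kx_closed Kx_b)+

text \<open>As \<open>W\<close> has degree 9, the degree hypotheses make
  \<open>h0 + h1 W + h2 W^2\<close> homogeneous of degree \<open>d + 18\<close>; the factor
  \<open>(a - b) p^2\<close> adds 63, giving the total degree \<open>d + 81\<close> demanded of
  \<open>Q\<close>. The component at \<open>a b\<close> is 0 and the other five are read off from
  \<open>nf\<close>.\<close>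

lemma admissible_nf:
  fixes i j :: 4
  defines "d \<equiv> deg_phi i + deg_phi j - 8"
  assumes Kx: "h0 \<in> Kx" "h1 \<in> Kx" "h2 \<in> Kx"
    and hom: "homogeneous (d + 18) h0" "homogeneous (d + 9) h1" "homogeneous d h2"
  shows "admissible_Q i j (cls (nf h0 h1 h2))"
proof -
  have cst_p: "homogeneous 18 (cst r * p)" for r
    by (intro homogeneous_cst_mult homogeneous_p)
  note pb1 = homogeneous_mult [OF cst_p homogeneous_b(1)]
  have "homogeneous (d + 54) (p^2 * h0)"
    using homogeneous_mult [OF homogeneous_power [OF homogeneous_p, of 2] hom(1)]
    by (simp add: algebra_simps)
  moreover have "homogeneous 27 (cst (1/12) * p * b1 + cst (1/2) * q)"
    using pb1 by (intro homogeneous_add homogeneous_cst_mult homogeneous_q) auto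
  from homogeneous_mult [OF homogeneous_mult [OF cst_p [of "1/2"] hom(2)] this]
  have "homogeneous (d + 54) (cst (1/2) * p * h1 * (cst (1/12) * p * b1 + cst (1/2) * q))"
    by (simp add: add.commute)
  moreover have "homogeneous 54 (cst (1/144) * p^2 * b1^2)"
    using homogeneous_mult [OF homogeneous_cst_mult [OF homogeneous_power [OF homogeneous_p, of 2]]
      homogeneous_power [OF homogeneous_b(1), of 2]] by simp
  then have "homogeneous 54 (cst (1/144) * p^2 * b1^2 + cst (1/12) * p * q * b1 - p^3)"
    using homogeneous_mult [OF homogeneous_mult [OF cst_p homogeneous_q] homogeneous_b(1)]
      homogeneous_power [OF homogeneous_p, of 3]
    by (intro homogeneous_add homogeneous_minus) auto
  then have "homogeneous (d + 54)
      (cst (1/4) * h2 * (cst (1/144) * p^2 * b1^2 + cst (1/12) * p * q * b1 - p^3))"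
    by (intro homogeneous_mult homogeneous_cst_mult hom)
  ultimately have hom_diff: "homogeneous (d + 54) (nf_diff h0 h1 h2)"
    unfolding nf_diff_def by (intro homogeneous_add)
  have hom_sum: "homogeneous (d + 27) (nf_sum h1 h2)"
    using homogeneous_mult [OF cst_p hom(2)] homogeneous_mult [OF pb1 hom(3)]
    unfolding nf_sum_def by (intro homogeneous_add) (auto simp: algebra_simps)
  have Kx_nf: "nf_diff h0 h1 h2 \<in> Kx" "nf_sum h1 h2 \<in> Kx"
    unfolding nf_diff_def nf_sum_def by (intro Kx_closed Kx Kx_b Kx_pq)+
  have nf_eq: "nf h0 h1 h2 = av * bv * 0 + av * nf_diff h0 h1 h2 + bv * (- nf_diff h0 h1 h2)
      + av * bv * cv * (cst (- 1/4) * h2) + av * cv * nf_sum h1 h2 + bv * cv * nf_sum h1 h2"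
    by (rule poly8_eqI) (simp add: nf_def algebra_simps)
  show ?thesis
    unfolding admissible_Q_def Let_def d_def [symmetric] nf_eq
    by (rule bexI [of _ 0], rule bexI [of _ "nf_diff h0 h1 h2"], rule bexI [of _ "- nf_diff h0 h1 h2"],
        rule bexI [of _ "cst (- 1/4) * h2"], rule bexI [of _ "nf_sum h1 h2"],
        rule bexI [of _ "nf_sum h1 h2"])
       (intro conjI refl homogeneous_zero homogeneous_uminus homogeneous_cst_mult hom_diff hom_sum
         hom Kx_closed Kx_nf Kx)+
qed

text \<open>The constant is 648 = 6 * 108: the 6 comes from \<open>F_eq_nf\<close>, the 108 from the
  integral scaling of \<open>cubic_deriv\<close>.\<close>

lemma F_cong:
  assumes "v \<in> {X, U 1, U 2, U 3, U 4}"
  shows "F (pd v) \<approx> cst (1/648) * (av - bv) * cubic_deriv v p half_w xv u1 u2 u3 u4"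
proof -
  have "F (pd v) \<approx> cst (1/6) * ((av - bv) * (p^2 * pd v b3 + p * half_w * pd v b2 + half_w^2 * pd v b1))"
    unfolding F_eq_nf by (intro I_cong_mult I_cong_refl nf_cong)
  also have "\<dots> = cst (1/648) * (av - bv) * cubic_deriv v p half_w xv u1 u2 u3 u4"
    by (rule poly8_eqI) (simp add: pd_b [OF assms] cubic_deriv_def algebra_simps)
  finally show ?thesis .
qed

lemma phi_cong: "\<phi> k \<approx> cst (1/648) * (av - bv) * cubic_deriv (U k) p half_w xv u1 u2 u3 u4"
  unfolding \<phi>_def using exhaust_4 [of k] by (intro F_cong) auto

lemma dxW_cong: "dxW \<approx> - cst (1/648) * (av - bv) * cubic_deriv X p half_w xv u1 u2 u3 u4"
  using I_cong_mult [OF I_cong_refl [of "- 1"] F_cong [of X]] by (simp add: dxW_def)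

text \<open>The hypothesis \<open>cert\<close> is the relation cleared of denominators: it expresses
  \<open>G_i G_j - (\<Sum>k. C_k G_k G_4)\<close> as a combination of \<open>\<partial>G/\<partial>x\<close> and \<open>G\<close>, where \<open>G\<close> is the cubic.\<close>

lemma mult_rel_from_certificate:
  fixes c c' :: "4 \<Rightarrow> poly8" and L :: complex
  defines "D v \<equiv> cubic_deriv v p half_w xv u1 u2 u3 u4"
  assumes c: "\<And>k. c k \<in> K"
      "\<And>k. homogeneous (deg_phi i + deg_phi j - deg_phi k - deg_phi 4) (c k)"
    and c': "\<And>k. cst L * c k = c' k" and L: "L \<noteq> 0"
    and Kx: "h0 \<in> Kx" "h1 \<in> Kx" "h2 \<in> Kx"
    and hom: "homogeneous (deg_phi i + deg_phi j + 10) h0" "homogeneous (deg_phi i + deg_phi j + 1) h1"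
      "homogeneous (deg_phi i + deg_phi j - 8) h2"
    and cert: "cst L * D (U i) * D (U j) = (\<Sum>k\<in>UNIV. c' k * D (U k) * D (U 4))
      + 108 * (p^2 * h0 + p * half_w * h1 + half_w^2 * h2) * D X
      + 108 * a * cubic p half_w xv u1 u2 u3 u4"
  shows "\<exists>Q. mult_rel i j c Q"
proof -
  \<comment> \<open>The scalar is 108/648 divided by \<open>L\<close>; the sign is the one in
    \<open>dxW = - F (pd X)\<close>.\<close>
  let ?r = "cst (- 1 / (6 * L))" and ?h = "p^2 * h0 + p * half_w * h1 + half_w^2 * h2"
  let ?Q = "nf (?r * h0) (?r * h1) (?r * h2)"
  have nf_scale: "nf (cst s * f0) (cst s * f1) (cst s * f2) = cst s * nf f0 f1 f2" for s f0 f1 f2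
    by (simp add: nf_def nf_diff_def nf_sum_def algebra_simps)
  note phi = phi_cong [folded D_def]
  note dxW = dxW_cong [folded D_def]
  have Q: "?Q \<approx> ?r * ((av - bv) * ?h)"
    unfolding nf_scale by (intro I_cong_mult I_cong_refl nf_cong)
  have "(\<Sum>k\<in>UNIV. c k * \<phi> k * \<phi> 4) + ?Q * dxW
      \<approx> (\<Sum>k\<in>UNIV. c k * (cst (1/648) * (av - bv) * D (U k)) * (cst (1/648) * (av - bv) * D (U 4)))
        + ?r * ((av - bv) * ?h) * (- cst (1/648) * (av - bv) * D X)"
    by (intro I_cong_add I_cong_sum I_cong_mult I_cong_refl phi Q dxW)
  also have "\<dots> = cst (1/648^2 / L) * (av - bv)^2 *
      ((\<Sum>k\<in>UNIV. (cst L * c k) * D (U k) * D (U 4)) + 108 * ?h * D X)"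
  proof -
    have e1: "c k * (cst (1/648) * (av - bv) * D (U k)) * (cst (1/648) * (av - bv) * D (U 4))
        = cst (1/648^2 / L) * (av - bv)^2 * (cst L * c k * D (U k) * D (U 4))" for k
      by (rule poly8_eqI) (simp add: L power2_eq_square)
    have e2: "?r * ((av - bv) * h) * (- cst (1/648) * (av - bv) * D X)
        = cst (1/648^2 / L) * (av - bv)^2 * (108 * h * D X)" for h
      by (rule poly8_eqI) (simp add: power2_eq_square)
    show ?thesis
      unfolding e1 e2 sum_distrib_left [symmetric] by (rule distrib_left [symmetric])
  qed
  also have "\<dots> = cst (1/648^2 / L) * (av - bv)^2 *
      (cst L * D (U i) * D (U j) - 108 * a * cubic p half_w xv u1 u2 u3 u4)"
    unfolding cert c' by simp
  also have "\<dots> \<approx> cst (1/648^2 / L) * (av - bv)^2 * (cst L * D (U i) * D (U j))"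
  proof -
    have "- cst (1/648^2 / L) * (av - bv)^2 * 108 * a * cubic p half_w xv u1 u2 u3 u4 \<in> I"
      by (intro I_mult cubic_I)
    then show ?thesis by (simp add: I_cong_def algebra_simps)
  qed
  also have "\<dots> = (cst (1/648) * (av - bv) * D (U i)) * (cst (1/648) * (av - bv) * D (U j))"
    by (rule poly8_eqI) (simp add: L power2_eq_square)
  also have "\<dots> \<approx> \<phi> i * \<phi> j"
    by (intro I_cong_mult I_cong_sym [OF phi])
  finally have "cls (\<phi> i * \<phi> j)
      = cls (\<Sum>k\<in>UNIV. c k * \<phi> k * \<phi> 4) \<oplus>\<^bsub>quot\<^esub> cls ?Q \<otimes>\<^bsub>quot\<^esub> cls dxW"
    by (simp add: cls_add cls_mult cls_eq_iff I_cong_def [symmetric] I_cong_sym)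
  moreover have "admissible_Q i j (cls ?Q)"
    using Kx hom by (intro admissible_nf Kx_closed homogeneous_cst_mult) (auto simp: algebra_simps)
  ultimately show ?thesis
    using c unfolding mult_rel_def by blast
qed

lemma ev_B [simp]:
  "ev z (B1 x k l m n) = B1 (ev z x) (ev z k) (ev z l) (ev z m) (ev z n)"
  "ev z (B2 x k l m n) = B2 (ev z x) (ev z k) (ev z l) (ev z m) (ev z n)"
  "ev z (B3 x k l m n) = B3 (ev z x) (ev z k) (ev z l) (ev z m) (ev z n)"
  by (simp_all add: B_defs)

lemma ev_G [simp]:
  "ev z (G0 v x k l m n) = G0 v (ev z x) (ev z k) (ev z l) (ev z m) (ev z n)"
  "ev z (G1 v x k l m n) = G1 v (ev z x) (ev z k) (ev z l) (ev z m) (ev z n)"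
  "ev z (G2 v x k l m n) = G2 v (ev z x) (ev z k) (ev z l) (ev z m) (ev z n)"
  by (cases v; simp)+

lemma ev_cubic [simp]:
  "ev z (cubic t w x k l m n) = cubic (ev z t) (ev z w) (ev z x) (ev z k) (ev z l) (ev z m) (ev z n)"
  "ev z (cubic_deriv v t w x k l m n)
    = cubic_deriv v (ev z t) (ev z w) (ev z x) (ev z k) (ev z l) (ev z m) (ev z n)"
  by (simp_all add: cubic_def cubic_deriv_def)

lemmas ev_simps = ev_add ev_minus ev_uminus ev_mult ev_power ev_zero ev_numeral ev_ind ev_cubic

subsection \<open>The structure constants\<close>

definition Cmat :: "4 \<Rightarrow> poly8^4^4" where
  "Cmat i =
    (if i = 1 then
      vector
          [vector [u1 * (cst (250/243) * u1^4 - cst (10/9) * u1 * u2 - cst (7/3) * u3),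
                   - cst (25/54) * u1^3 + cst (1/4) * u2,
                   - cst (5/3) * u1^2,
                   1],
           vector [cst (100/81) * u1^4 * u2 + cst (140/27) * u1^3 * u3 - cst (2/3) * u1 * u2^2
                     - cst (4/3) * u1 * u4 - 2 * u2 * u3,
                   u1 * (- cst (5/9) * u1 * u2 - cst (7/3) * u3),
                   - 6 * u3 - 2 * u1 * u2,
                   0],
           vector [- cst (2/9) * u1 * u2 * u3 - cst (2/3) * u3^2 + cst (100/243) * u1^4 * u3
                     - cst (10/27) * u1^2 * u4,
                   cst (1/6) * u4 - cst (5/27) * u1^2 * u3,
                   - cst (2/3) * u1 * u3,
                   0],
           vector [cst (10/9) * u1^2 * u3^2 - cst (1/3) * u1 * u2 * u4 - u3 * u4
                     + cst (50/81) * u1^4 * u4,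
                   - cst (1/2) * u3^2 - cst (5/18) * u1^2 * u4,
                   - u1 * u4,
                   0]]
    else if i = 2 then
      vector
          [vector [- cst (25/54) * u1^3 + cst (1/4) * u2, cst (5/24) * u1, cst (3/4), 0],
           vector [u1 * (- cst (5/9) * u1 * u2 - cst (7/3) * u3), cst (1/4) * u2, 0, 1],
           vector [cst (1/6) * u4 - cst (5/27) * u1^2 * u3, cst (1/12) * u3, 0, 0],
           vector [- cst (1/2) * u3^2 - cst (5/18) * u1^2 * u4, cst (1/8) * u4, 0, 0]]
    else if i = 3 then
      vector
          [vector [- cst (5/3) * u1^2, cst (3/4), 0, 0],
           vector [- 6 * u3 - 2 * u1 * u2, 0, - 6 * u1, 0],
           vector [- cst (2/3) * u1 * u3, 0, 0, 1],
           vector [- u1 * u4, 0, - cst (9/2) * u3, 0]]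
    else mat 1)"

lemma deg_phi_simps: "deg_phi 1 = 7" "deg_phi 2 = 3" "deg_phi 3 = 1" "deg_phi 4 = - 3"
  by (simp_all add: deg_phi_def)

lemma Cmat_K: "Cmat i $ k $ j \<in> K"
proof -
  have "\<forall>i k j. Cmat i $ k $ j \<in> K"
    unfolding forall_4 Cmat_def K_def
    by (simp add: mat_def; intro conjI;
        (intro polys_in_add polys_in_minus polys_in_mult polys_in_power polys_in_uminus
          polys_in_cst polys_in_numeral polys_in_one polys_in_zero polys_in_ind; simp)?)
  then show ?thesis by blast
qed

lemma Cmat_homogeneous:
  "homogeneous (deg_phi i + deg_phi j - deg_phi k - deg_phi 4) (Cmat i $ k $ j)"
proof -
  have "\<forall>i j k. homogeneous (deg_phi i + deg_phi j - deg_phi k - deg_phi 4) (Cmat i $ k $ j)"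
    unfolding forall_4 Cmat_def
    by (simp add: mat_def deg_phi_simps homogeneous_zero homogeneous_one; intro conjI;
        (intro homogeneous_intros; simp)?)
  then show ?thesis by blast
qed

text \<open>Reflects commutativity of the product. With the trivial column \<open>j = 4\<close>, it
  leaves only six pairs to be certified.\<close>

lemma Cmat_symmetric: "Cmat i $ k $ j = Cmat j $ k $ i"
proof -
  have "\<forall>i k j. Cmat i $ k $ j = Cmat j $ k $ i"
    unfolding forall_4 Cmat_def by (simp add: mat_def)
  then show ?thesis by blast
qed

text \<open>The factor 13122 clears all denominators, so the identity has integer coefficients and
  makes sense over any domain; the coefficients of the products with \<open>U 4\<close> are 13122
  times the first column of \<open>Cmat 1\<close>. Every term has degree 4 in \<open>(t, w)\<close>:
  the cofactor of the \<open>x\<close>-derivative is quadratic there and that of the cubic is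
  linear. The five certificates that follow have the same shape with their own scaling.\<close>

lemma certificate_11:
  fixes t w x k l m n :: "'a::idom"
  shows "13122 * cubic_deriv (U 1) t w x k l m n * cubic_deriv (U 1) t w x k l m n
    - ((13500 * k^5 - 14580 * k^2 * l - 30618 * k * m) * cubic_deriv (U 1) t w x k l m n * cubic_deriv (U 4) t w x k l m n
      + (16200 * k^4 * l + 68040 * k^3 * m - 8748 * k * l^2 - 17496 * k * n - 26244 * l * m) * cubic_deriv (U 2) t w x k l m n * cubic_deriv (U 4) t w x k l m n
      + (5400 * k^4 * m - 4860 * k^2 * n - 2916 * k * l * m - 8748 * m^2) * cubic_deriv (U 3) t w x k l m n * cubic_deriv (U 4) t w x k l m n
      + (8100 * k^4 * n + 14580 * k^2 * m^2 - 4374 * k * l * n - 13122 * m * n) * cubic_deriv (U 4) t w x k l m n * cubic_deriv (U 4) t w x k l m n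
      + 108 * (t^2 * (26244 * x^24 + 116640 * x^22 * k + 191160 * x^20 * k^2 + 129600 * x^18 * k^3 + 17496 * x^18 * l
      + 22680 * x^16 * k^4 + 38394 * x^16 * k * l + 21870 * x^16 * m - 27936 * x^14 * k^5 + 42066 * x^14 * k^2 * l
      + 39852 * x^14 * k * m - 16380 * x^12 * k^6 + 12582 * x^12 * k^3 * l + 2214 * x^12 * k^2 * m
      + 2916 * x^12 * l^2 + 8748 * x^12 * n - 2600 * x^10 * k^7 - 846 * x^10 * k^4 * l - 864 * x^10 * k^3 * m
      + 1782 * x^10 * k * l^2 + 6804 * x^10 * k * n - 4374 * x^10 * l * m - 600 * x^8 * k^5 * l
      + 3330 * x^8 * k^4 * m + 234 * x^8 * k^2 * l^2 + 486 * x^8 * k^2 * n - 2511 * x^8 * k * l * m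
      - 1458 * x^8 * m^2 + 900 * x^6 * k^5 * m - 90 * x^6 * k^3 * n - 261 * x^6 * k^2 * l * m
      - 648 * x^6 * k * m^2 + 100 * x^4 * k^4 * n - 90 * x^4 * k^2 * m^2 - 54 * x^4 * k * l * n
      - 162 * x^4 * m * n) + t * w * (- 656100 * x^15 - 833976 * x^13 * k - 543024 * x^11 * k^2 - 66744 * x^9 * k^3 - 61236 * x^9 * l
      + 32400 * x^7 * k^4 - 28674 * x^7 * k * l - 17496 * x^7 * m + 3600 * x^5 * k^5 - 54 * x^5 * k^2 * l
      - 972 * x^5 * k * m - 540 * x^3 * k^2 * m) + w^2 * (- 209952 * x^6 - 58320 * x^4 * k + 6480 * x^2 * k^2)) * cubic_deriv X t w x k l m n
      + 108 * (t * (- 236196 * x^23 - 944784 * x^21 * k - 1242216 * x^19 * k^2 - 400464 * x^17 * k^3 - 157464 * x^17 * l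
      + 206064 * x^15 * k^4 - 231822 * x^15 * k * l - 13122 * x^15 * m + 275400 * x^13 * k^5
      - 222102 * x^13 * k^2 * l - 58320 * x^13 * k * m + 72900 * x^11 * k^6 - 10530 * x^11 * k^3 * l
      + 121662 * x^11 * k^2 * m - 26244 * x^11 * l^2 - 26244 * x^11 * n + 20250 * x^9 * k^4 * l
      - 8100 * x^9 * k^3 * m - 7290 * x^9 * k * l^2 - 8748 * x^9 * k * n + 48114 * x^9 * l * m
      - 27270 * x^7 * k^4 * m + 810 * x^7 * k^2 * l^2 - 2430 * x^7 * k^2 * n + 13365 * x^7 * k * l * m
      - 8748 * x^7 * m^2 - 1350 * x^5 * k^3 * n - 1485 * x^5 * k^2 * l * m - 2430 * x^5 * k * m^2
      + 270 * x^3 * k^2 * m^2) + w * (2598156 * x^14 + 2361960 * x^12 * k + 1854576 * x^10 * k^2 + 48600 * x^8 * k^3 + 393660 * x^8 * l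
      - 194400 * x^6 * k^4 + 109350 * x^6 * k * l - 52488 * x^6 * m - 12150 * x^4 * k^2 * l
      - 14580 * x^4 * k * m + 1620 * x^2 * k^2 * m)) * cubic t w x k l m n) = 0"
  unfolding cubic_unfold by Groebner_Basis.algebra

lemma certificate_12:
  fixes t w x k l m n :: "'a::idom"
  shows "5832 * cubic_deriv (U 1) t w x k l m n * cubic_deriv (U 2) t w x k l m n
    - ((- 2700 * k^3 + 1458 * l) * cubic_deriv (U 1) t w x k l m n * cubic_deriv (U 4) t w x k l m n
      + (- 3240 * k^2 * l - 13608 * k * m) * cubic_deriv (U 2) t w x k l m n * cubic_deriv (U 4) t w x k l m n
      + (- 1080 * k^2 * m + 972 * n) * cubic_deriv (U 3) t w x k l m n * cubic_deriv (U 4) t w x k l m n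
      + (- 1620 * k^2 * n - 2916 * m^2) * cubic_deriv (U 4) t w x k l m n * cubic_deriv (U 4) t w x k l m n
      + 108 * (t^2 * (2592 * x^20 + 9072 * x^18 * k + 10044 * x^16 * k^2 + 7920 * x^14 * k^3 - 1026 * x^14 * l
      + 3276 * x^12 * k^4 + 108 * x^12 * k * l + 2376 * x^12 * m + 520 * x^10 * k^5 + 450 * x^10 * k^2 * l
      + 432 * x^10 * k * m + 120 * x^8 * k^3 * l - 666 * x^8 * k^2 * m + 18 * x^8 * l^2 + 162 * x^8 * n
      - 180 * x^6 * k^3 * m + 18 * x^6 * k * n - 45 * x^6 * l * m - 20 * x^4 * k^2 * n + 18 * x^4 * m^2) + t * w * (21708 * x^11 - 648 * x^9 * k - 6480 * x^7 * k^2 - 720 * x^5 * k^3 - 378 * x^5 * l + 108 * x^3 * m) + w^2 * (- 1296 * x^2)) * cubic_deriv X t w x k l m n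
      + 108 * (t * (- 34992 * x^19 - 108864 * x^17 * k - 88452 * x^15 * k^2 - 55080 * x^13 * k^3 + 11178 * x^13 * l
      - 14580 * x^11 * k^4 - 2268 * x^11 * k * l - 18792 * x^11 * m - 4050 * x^9 * k^2 * l + 648 * x^9 * k * m
      + 5454 * x^7 * k^2 * m - 162 * x^7 * l^2 + 486 * x^7 * n + 270 * x^5 * k * n + 297 * x^5 * l * m
      - 54 * x^3 * m^2) + w * (- 166212 * x^10 - 9720 * x^8 * k + 38880 * x^6 * k^2 + 2430 * x^4 * l - 324 * x^2 * m)) * cubic t w x k l m n) = 0"
  unfolding cubic_unfold by Groebner_Basis.algebra

lemma certificate_13:
  fixes t w x k l m n :: "'a::idom"
  shows "162 * cubic_deriv (U 1) t w x k l m n * cubic_deriv (U 3) t w x k l m n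
    - ((- 270 * k^2) * cubic_deriv (U 1) t w x k l m n * cubic_deriv (U 4) t w x k l m n
      + (- 324 * k * l - 972 * m) * cubic_deriv (U 2) t w x k l m n * cubic_deriv (U 4) t w x k l m n
      + (- 108 * k * m) * cubic_deriv (U 3) t w x k l m n * cubic_deriv (U 4) t w x k l m n
      + (- 162 * k * n) * cubic_deriv (U 4) t w x k l m n * cubic_deriv (U 4) t w x k l m n
      + 108 * (t^2 * (324 * x^18 + 594 * x^16 * k + 684 * x^14 * k^2 + 306 * x^12 * k^3 + 108 * x^12 * l + 52 * x^10 * k^4
      + 54 * x^10 * k * l - 216 * x^10 * m + 12 * x^8 * k^2 * l - 117 * x^8 * k * m - 18 * x^6 * k^2 * m
      - 9 * x^6 * n - 2 * x^4 * k * n) + t * w * (- 2106 * x^9 - 864 * x^7 * k - 72 * x^5 * k^2) + w^2 * (0)) * cubic_deriv X t w x k l m n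
      + 108 * (t * (- 3888 * x^17 - 5346 * x^15 * k - 5508 * x^13 * k^2 - 1458 * x^11 * k^3 - 1296 * x^11 * l
      - 486 * x^9 * k * l + 1782 * x^9 * m + 729 * x^7 * k * m + 27 * x^5 * n) + w * (12150 * x^8 + 3888 * x^6 * k)) * cubic t w x k l m n) = 0"
  unfolding cubic_unfold by Groebner_Basis.algebra

lemma certificate_22:
  fixes t w x k l m n :: "'a::idom"
  shows "1296 * cubic_deriv (U 2) t w x k l m n * cubic_deriv (U 2) t w x k l m n
    - ((270 * k) * cubic_deriv (U 1) t w x k l m n * cubic_deriv (U 4) t w x k l m n
      + (324 * l) * cubic_deriv (U 2) t w x k l m n * cubic_deriv (U 4) t w x k l m n
      + (108 * m) * cubic_deriv (U 3) t w x k l m n * cubic_deriv (U 4) t w x k l m n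
      + (162 * n) * cubic_deriv (U 4) t w x k l m n * cubic_deriv (U 4) t w x k l m n
      + 108 * (t^2 * (162 * x^16 - 144 * x^14 * k - 198 * x^12 * k^2 - 52 * x^10 * k^3 - 18 * x^10 * l - 12 * x^8 * k * l
      + 45 * x^8 * m + 18 * x^6 * k * m + 2 * x^4 * n) + t * w * (486 * x^7 + 72 * x^5 * k) + w^2 * (0)) * cubic_deriv X t w x k l m n
      + 108 * (t * (- 3078 * x^15 + 324 * x^13 * k + 810 * x^11 * k^2 + 270 * x^9 * l - 459 * x^7 * m) + w * (- 4050 * x^6)) * cubic t w x k l m n) = 0"
  unfolding cubic_unfold by Groebner_Basis.algebra

lemma certificate_23:
  fixes t w x k l m n :: "'a::idom"
  shows "72 * cubic_deriv (U 2) t w x k l m n * cubic_deriv (U 3) t w x k l m n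
    - ((54) * cubic_deriv (U 1) t w x k l m n * cubic_deriv (U 4) t w x k l m n
      + (0) * cubic_deriv (U 2) t w x k l m n * cubic_deriv (U 4) t w x k l m n
      + (0) * cubic_deriv (U 3) t w x k l m n * cubic_deriv (U 4) t w x k l m n
      + (0) * cubic_deriv (U 4) t w x k l m n * cubic_deriv (U 4) t w x k l m n
      + 108 * (t^2 * (- 78 * x^14 - 60 * x^12 * k - 14 * x^10 * k^2 - 2 * x^8 * l + x^6 * m) + t * w * (- 6 * x^5) + w^2 * (0)) * cubic_deriv X t w x k l m n
      + 108 * (t * (846 * x^13 + 396 * x^11 * k + 30 * x^9 * k^2 - 6 * x^7 * l + 15 * x^5 * m) + w * (90 * x^4)) * cubic t w x k l m n) = 0"
  unfolding cubic_unfold by Groebner_Basis.algebra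

lemma certificate_33:
  fixes t w x k l m n :: "'a::idom"
  shows "36 * cubic_deriv (U 3) t w x k l m n * cubic_deriv (U 3) t w x k l m n
    - ((0) * cubic_deriv (U 1) t w x k l m n * cubic_deriv (U 4) t w x k l m n
      + (- 216 * k) * cubic_deriv (U 2) t w x k l m n * cubic_deriv (U 4) t w x k l m n
      + (0) * cubic_deriv (U 3) t w x k l m n * cubic_deriv (U 4) t w x k l m n
      + (- 162 * m) * cubic_deriv (U 4) t w x k l m n * cubic_deriv (U 4) t w x k l m n
      + 108 * (t^2 * (78 * x^12 + 60 * x^10 * k + 14 * x^8 * k^2 + 2 * x^6 * l - x^4 * m) + t * w * (6 * x^3) + w^2 * (0)) * cubic_deriv X t w x k l m n
      + 108 * (t * (- 1206 * x^11 - 684 * x^9 * k - 102 * x^7 * k^2 - 6 * x^5 * l - 3 * x^3 * m) + w * (- 18 * x^2)) * cubic t w x k l m n) = 0"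
  unfolding cubic_unfold by Groebner_Basis.algebra

section \<open>From certificates to relations\<close>

lemma mult_rel_sym: "mult_rel i j c Q = mult_rel j i c Q"
  by (simp add: mult_rel_def admissible_Q_def add.commute mult.commute)

text \<open>The last column of \<open>Cmat i\<close> is the \<open>i\<close>-th unit vector, so the
  relation is a tautology with \<open>Q = 0\<close>.\<close>

lemma ex_mult_rel_4: "\<exists>Q. mult_rel i 4 (\<lambda>k. Cmat i $ k $ 4) Q"
proof (rule mult_rel_from_certificate [where L = 1 and a = 0 and ?h0.0 = 0 and ?h1.0 = 0 and ?h2.0 = 0])
  have "\<forall>i k. Cmat i $ k $ 4 = (if k = i then 1 else 0)"
    unfolding forall_4 Cmat_def by (simp add: mat_def)
  then show "cst 1 * cubic_deriv (U i) p half_w xv u1 u2 u3 u4 * cubic_deriv (U 4) p half_w xv u1 u2 u3 u4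
    = (\<Sum>k\<in>UNIV. Cmat i $ k $ 4 * cubic_deriv (U k) p half_w xv u1 u2 u3 u4
        * cubic_deriv (U 4) p half_w xv u1 u2 u3 u4)
      + 108 * (p^2 * 0 + p * half_w * 0 + half_w^2 * 0) * cubic_deriv X p half_w xv u1 u2 u3 u4
      + 108 * 0 * cubic p half_w xv u1 u2 u3 u4"
    by (simp add: cst_one if_distrib [of "\<lambda>x. x * _"] sum.delta cong: if_cong)
qed (rule Cmat_K Cmat_homogeneous homogeneous_zero Kx_closed | simp add: cst_one)+

lemmas Kx_intros = polys_in_add polys_in_minus polys_in_mult polys_in_power polys_in_uminus
  polys_in_cst polys_in_numeral polys_in_one polys_in_zero polys_in_ind

text \<open>The instantiation is \<open>certificate_11\<close> at \<open>t = p\<close>,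
  \<open>w = half_w\<close>. Goal 3 compares the scaled constants, goals 5 to 7 are membership in
  \<open>Kx\<close>, goals 8 to 10 the degrees, and goal 11 the certificate itself. The other five
  pairs are treated in the same way.\<close>

lemma ex_mult_rel_11: "\<exists>Q. mult_rel 1 1 (\<lambda>k. Cmat 1 $ k $ 1) Q"
proof (rule mult_rel_from_certificate [where L = 13122
    and c' = "\<lambda>k. (vector [13500 * u1^5 - 14580 * u1^2 * u2 - 30618 * u1 * u3, 16200 * u1^4 * u2 + 68040 * u1^3 * u3 - 8748 * u1 * u2^2 - 17496 * u1 * u4 - 26244 * u2 * u3, 5400 * u1^4 * u3 - 4860 * u1^2 * u4 - 2916 * u1 * u2 * u3 - 8748 * u3^2, 8100 * u1^4 * u4 + 14580 * u1^2 * u3^2 - 4374 * u1 * u2 * u4 - 13122 * u3 * u4] :: poly8^4) $ k"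
    and ?h0.0 = "26244 * xv^24 + 116640 * xv^22 * u1 + 191160 * xv^20 * u1^2 + 129600 * xv^18 * u1^3 + 17496 * xv^18 * u2
      + 22680 * xv^16 * u1^4 + 38394 * xv^16 * u1 * u2 + 21870 * xv^16 * u3 - 27936 * xv^14 * u1^5
      + 42066 * xv^14 * u1^2 * u2 + 39852 * xv^14 * u1 * u3 - 16380 * xv^12 * u1^6 + 12582 * xv^12 * u1^3 * u2
      + 2214 * xv^12 * u1^2 * u3 + 2916 * xv^12 * u2^2 + 8748 * xv^12 * u4 - 2600 * xv^10 * u1^7
      - 846 * xv^10 * u1^4 * u2 - 864 * xv^10 * u1^3 * u3 + 1782 * xv^10 * u1 * u2^2 + 6804 * xv^10 * u1 * u4
      - 4374 * xv^10 * u2 * u3 - 600 * xv^8 * u1^5 * u2 + 3330 * xv^8 * u1^4 * u3 + 234 * xv^8 * u1^2 * u2^2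
      + 486 * xv^8 * u1^2 * u4 - 2511 * xv^8 * u1 * u2 * u3 - 1458 * xv^8 * u3^2 + 900 * xv^6 * u1^5 * u3
      - 90 * xv^6 * u1^3 * u4 - 261 * xv^6 * u1^2 * u2 * u3 - 648 * xv^6 * u1 * u3^2 + 100 * xv^4 * u1^4 * u4
      - 90 * xv^4 * u1^2 * u3^2 - 54 * xv^4 * u1 * u2 * u4 - 162 * xv^4 * u3 * u4"
    and ?h1.0 = "- 656100 * xv^15 - 833976 * xv^13 * u1 - 543024 * xv^11 * u1^2 - 66744 * xv^9 * u1^3 - 61236 * xv^9 * u2
      + 32400 * xv^7 * u1^4 - 28674 * xv^7 * u1 * u2 - 17496 * xv^7 * u3 + 3600 * xv^5 * u1^5
      - 54 * xv^5 * u1^2 * u2 - 972 * xv^5 * u1 * u3 - 540 * xv^3 * u1^2 * u3"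
    and ?h2.0 = "- 209952 * xv^6 - 58320 * xv^4 * u1 + 6480 * xv^2 * u1^2"
    and a = "p * (- 236196 * xv^23 - 944784 * xv^21 * u1 - 1242216 * xv^19 * u1^2 - 400464 * xv^17 * u1^3
      - 157464 * xv^17 * u2 + 206064 * xv^15 * u1^4 - 231822 * xv^15 * u1 * u2 - 13122 * xv^15 * u3
      + 275400 * xv^13 * u1^5 - 222102 * xv^13 * u1^2 * u2 - 58320 * xv^13 * u1 * u3 + 72900 * xv^11 * u1^6
      - 10530 * xv^11 * u1^3 * u2 + 121662 * xv^11 * u1^2 * u3 - 26244 * xv^11 * u2^2 - 26244 * xv^11 * u4
      + 20250 * xv^9 * u1^4 * u2 - 8100 * xv^9 * u1^3 * u3 - 7290 * xv^9 * u1 * u2^2 - 8748 * xv^9 * u1 * u4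
      + 48114 * xv^9 * u2 * u3 - 27270 * xv^7 * u1^4 * u3 + 810 * xv^7 * u1^2 * u2^2 - 2430 * xv^7 * u1^2 * u4
      + 13365 * xv^7 * u1 * u2 * u3 - 8748 * xv^7 * u3^2 - 1350 * xv^5 * u1^3 * u4 - 1485 * xv^5 * u1^2 * u2 * u3
      - 2430 * xv^5 * u1 * u3^2 + 270 * xv^3 * u1^2 * u3^2) + half_w * (2598156 * xv^14 + 2361960 * xv^12 * u1 + 1854576 * xv^10 * u1^2 + 48600 * xv^8 * u1^3
      + 393660 * xv^8 * u2 - 194400 * xv^6 * u1^4 + 109350 * xv^6 * u1 * u2 - 52488 * xv^6 * u3
      - 12150 * xv^4 * u1^2 * u2 - 14580 * xv^4 * u1 * u3 + 1620 * xv^2 * u1^2 * u3)"], goal_cases)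
  case (3 k)
  show ?case
    using exhaust_4 [of k]
    by (elim disjE; hypsubst; intro poly8_eqI;
        simp add: Cmat_def algebra_simps power_numeral_reduce)
next
  case 11
  show ?case
    unfolding sum_4 vector_4 numeral_eq_cst [symmetric]
    \<comment> \<open>Evaluation moves the identity to the complex numbers, a domain, where the
      certificate applies.\<close>
    by (rule poly8_eqI, simp only: ev_simps, rule certificate_11 [THEN eq_iff_diff_eq_0 [THEN iffD2]])
next
  case 5 show ?case unfolding Kx_def by (intro Kx_intros; simp)
next
  case 6 show ?case unfolding Kx_def by (intro Kx_intros; simp)
next
  case 7 show ?case unfolding Kx_def by (intro Kx_intros; simp)
next
  case 8 show ?case unfolding deg_phi_simps by (intro homogeneous_intros; simp)
next
  case 9 show ?case unfolding deg_phi_simps by (intro homogeneous_intros; simp)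
next
  case 10 show ?case unfolding deg_phi_simps by (intro homogeneous_intros; simp)
qed (rule Cmat_K Cmat_homogeneous | simp)+

lemma ex_mult_rel_12: "\<exists>Q. mult_rel 1 2 (\<lambda>k. Cmat 1 $ k $ 2) Q"
proof (rule mult_rel_from_certificate [where L = 5832
    and c' = "\<lambda>k. (vector [- 2700 * u1^3 + 1458 * u2, - 3240 * u1^2 * u2 - 13608 * u1 * u3, - 1080 * u1^2 * u3 + 972 * u4, - 1620 * u1^2 * u4 - 2916 * u3^2] :: poly8^4) $ k"
    and ?h0.0 = "2592 * xv^20 + 9072 * xv^18 * u1 + 10044 * xv^16 * u1^2 + 7920 * xv^14 * u1^3 - 1026 * xv^14 * u2
      + 3276 * xv^12 * u1^4 + 108 * xv^12 * u1 * u2 + 2376 * xv^12 * u3 + 520 * xv^10 * u1^5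
      + 450 * xv^10 * u1^2 * u2 + 432 * xv^10 * u1 * u3 + 120 * xv^8 * u1^3 * u2 - 666 * xv^8 * u1^2 * u3
      + 18 * xv^8 * u2^2 + 162 * xv^8 * u4 - 180 * xv^6 * u1^3 * u3 + 18 * xv^6 * u1 * u4 - 45 * xv^6 * u2 * u3
      - 20 * xv^4 * u1^2 * u4 + 18 * xv^4 * u3^2"
    and ?h1.0 = "21708 * xv^11 - 648 * xv^9 * u1 - 6480 * xv^7 * u1^2 - 720 * xv^5 * u1^3 - 378 * xv^5 * u2
      + 108 * xv^3 * u3"
    and ?h2.0 = "- 1296 * xv^2"
    and a = "p * (- 34992 * xv^19 - 108864 * xv^17 * u1 - 88452 * xv^15 * u1^2 - 55080 * xv^13 * u1^3 + 11178 * xv^13 * u2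
      - 14580 * xv^11 * u1^4 - 2268 * xv^11 * u1 * u2 - 18792 * xv^11 * u3 - 4050 * xv^9 * u1^2 * u2
      + 648 * xv^9 * u1 * u3 + 5454 * xv^7 * u1^2 * u3 - 162 * xv^7 * u2^2 + 486 * xv^7 * u4
      + 270 * xv^5 * u1 * u4 + 297 * xv^5 * u2 * u3 - 54 * xv^3 * u3^2) + half_w * (- 166212 * xv^10 - 9720 * xv^8 * u1 + 38880 * xv^6 * u1^2 + 2430 * xv^4 * u2 - 324 * xv^2 * u3)"], goal_cases)
  case (3 k)
  show ?case
    using exhaust_4 [of k]
    by (elim disjE; hypsubst; intro poly8_eqI;
        simp add: Cmat_def algebra_simps power_numeral_reduce)
next
  case 11
  show ?case
    unfolding sum_4 vector_4 numeral_eq_cst [symmetric]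
    by (rule poly8_eqI, simp only: ev_simps, rule certificate_12 [THEN eq_iff_diff_eq_0 [THEN iffD2]])
next
  case 5 show ?case unfolding Kx_def by (intro Kx_intros; simp)
next
  case 6 show ?case unfolding Kx_def by (intro Kx_intros; simp)
next
  case 7 show ?case unfolding Kx_def by (intro Kx_intros; simp)
next
  case 8 show ?case unfolding deg_phi_simps by (intro homogeneous_intros; simp)
next
  case 9 show ?case unfolding deg_phi_simps by (intro homogeneous_intros; simp)
next
  case 10 show ?case unfolding deg_phi_simps by (intro homogeneous_intros; simp)
qed (rule Cmat_K Cmat_homogeneous | simp)+

lemma ex_mult_rel_13: "\<exists>Q. mult_rel 1 3 (\<lambda>k. Cmat 1 $ k $ 3) Q"
proof (rule mult_rel_from_certificate [where L = 162
    and c' = "\<lambda>k. (vector [- 270 * u1^2, - 324 * u1 * u2 - 972 * u3, - 108 * u1 * u3, - 162 * u1 * u4] :: poly8^4) $ k"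
    and ?h0.0 = "324 * xv^18 + 594 * xv^16 * u1 + 684 * xv^14 * u1^2 + 306 * xv^12 * u1^3 + 108 * xv^12 * u2
      + 52 * xv^10 * u1^4 + 54 * xv^10 * u1 * u2 - 216 * xv^10 * u3 + 12 * xv^8 * u1^2 * u2
      - 117 * xv^8 * u1 * u3 - 18 * xv^6 * u1^2 * u3 - 9 * xv^6 * u4 - 2 * xv^4 * u1 * u4"
    and ?h1.0 = "- 2106 * xv^9 - 864 * xv^7 * u1 - 72 * xv^5 * u1^2"
    and ?h2.0 = "0"
    and a = "p * (- 3888 * xv^17 - 5346 * xv^15 * u1 - 5508 * xv^13 * u1^2 - 1458 * xv^11 * u1^3 - 1296 * xv^11 * u2
      - 486 * xv^9 * u1 * u2 + 1782 * xv^9 * u3 + 729 * xv^7 * u1 * u3 + 27 * xv^5 * u4) + half_w * (12150 * xv^8 + 3888 * xv^6 * u1)"], goal_cases)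
  case (3 k)
  show ?case
    using exhaust_4 [of k]
    by (elim disjE; hypsubst; intro poly8_eqI;
        simp add: Cmat_def algebra_simps power_numeral_reduce)
next
  case 11
  show ?case
    unfolding sum_4 vector_4 numeral_eq_cst [symmetric]
    by (rule poly8_eqI, simp only: ev_simps, rule certificate_13 [THEN eq_iff_diff_eq_0 [THEN iffD2]])
next
  case 5 show ?case unfolding Kx_def by (intro Kx_intros; simp)
next
  case 6 show ?case unfolding Kx_def by (intro Kx_intros; simp)
next
  case 7 show ?case unfolding Kx_def by (intro Kx_intros; simp)
next
  case 8 show ?case unfolding deg_phi_simps by (intro homogeneous_intros; simp)
next
  case 9 show ?case unfolding deg_phi_simps by (intro homogeneous_intros; simp)
next
  case 10 show ?case unfolding deg_phi_simps by (intro homogeneous_intros; simp)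
qed (rule Cmat_K Cmat_homogeneous | simp)+

lemma ex_mult_rel_22: "\<exists>Q. mult_rel 2 2 (\<lambda>k. Cmat 2 $ k $ 2) Q"
proof (rule mult_rel_from_certificate [where L = 1296
    and c' = "\<lambda>k. (vector [270 * u1, 324 * u2, 108 * u3, 162 * u4] :: poly8^4) $ k"
    and ?h0.0 = "162 * xv^16 - 144 * xv^14 * u1 - 198 * xv^12 * u1^2 - 52 * xv^10 * u1^3 - 18 * xv^10 * u2
      - 12 * xv^8 * u1 * u2 + 45 * xv^8 * u3 + 18 * xv^6 * u1 * u3 + 2 * xv^4 * u4"
    and ?h1.0 = "486 * xv^7 + 72 * xv^5 * u1"
    and ?h2.0 = "0"
    and a = "p * (- 3078 * xv^15 + 324 * xv^13 * u1 + 810 * xv^11 * u1^2 + 270 * xv^9 * u2 - 459 * xv^7 * u3) + half_w * (- 4050 * xv^6)"], goal_cases)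
  case (3 k)
  show ?case
    using exhaust_4 [of k]
    by (elim disjE; hypsubst; intro poly8_eqI;
        simp add: Cmat_def algebra_simps power_numeral_reduce)
next
  case 11
  show ?case
    unfolding sum_4 vector_4 numeral_eq_cst [symmetric]
    by (rule poly8_eqI, simp only: ev_simps, rule certificate_22 [THEN eq_iff_diff_eq_0 [THEN iffD2]])
next
  case 5 show ?case unfolding Kx_def by (intro Kx_intros; simp)
next
  case 6 show ?case unfolding Kx_def by (intro Kx_intros; simp)
next
  case 7 show ?case unfolding Kx_def by (intro Kx_intros; simp)
next
  case 8 show ?case unfolding deg_phi_simps by (intro homogeneous_intros; simp)
next
  case 9 show ?case unfolding deg_phi_simps by (intro homogeneous_intros; simp)
next
  case 10 show ?case unfolding deg_phi_simps by (intro homogeneous_intros; simp)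
qed (rule Cmat_K Cmat_homogeneous | simp)+

lemma ex_mult_rel_23: "\<exists>Q. mult_rel 2 3 (\<lambda>k. Cmat 2 $ k $ 3) Q"
proof (rule mult_rel_from_certificate [where L = 72
    and c' = "\<lambda>k. (vector [54, 0, 0, 0] :: poly8^4) $ k"
    and ?h0.0 = "- 78 * xv^14 - 60 * xv^12 * u1 - 14 * xv^10 * u1^2 - 2 * xv^8 * u2 + xv^6 * u3"
    and ?h1.0 = "- 6 * xv^5"
    and ?h2.0 = "0"
    and a = "p * (846 * xv^13 + 396 * xv^11 * u1 + 30 * xv^9 * u1^2 - 6 * xv^7 * u2 + 15 * xv^5 * u3) + half_w * (90 * xv^4)"], goal_cases)
  case (3 k)
  show ?case
    using exhaust_4 [of k]
    by (elim disjE; hypsubst; intro poly8_eqI;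
        simp add: Cmat_def algebra_simps power_numeral_reduce)
next
  case 11
  show ?case
    unfolding sum_4 vector_4 numeral_eq_cst [symmetric]
    by (rule poly8_eqI, simp only: ev_simps, rule certificate_23 [THEN eq_iff_diff_eq_0 [THEN iffD2]])
next
  case 5 show ?case unfolding Kx_def by (intro Kx_intros; simp)
next
  case 6 show ?case unfolding Kx_def by (intro Kx_intros; simp)
next
  case 7 show ?case unfolding Kx_def by (intro Kx_intros; simp)
next
  case 8 show ?case unfolding deg_phi_simps by (intro homogeneous_intros; simp)
next
  case 9 show ?case unfolding deg_phi_simps by (intro homogeneous_intros; simp)
next
  case 10 show ?case unfolding deg_phi_simps by (intro homogeneous_intros; simp)
qed (rule Cmat_K Cmat_homogeneous | simp)+

lemma ex_mult_rel_33: "\<exists>Q. mult_rel 3 3 (\<lambda>k. Cmat 3 $ k $ 3) Q"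
proof (rule mult_rel_from_certificate [where L = 36
    and c' = "\<lambda>k. (vector [0, - 216 * u1, 0, - 162 * u3] :: poly8^4) $ k"
    and ?h0.0 = "78 * xv^12 + 60 * xv^10 * u1 + 14 * xv^8 * u1^2 + 2 * xv^6 * u2 - xv^4 * u3"
    and ?h1.0 = "6 * xv^3"
    and ?h2.0 = "0"
    and a = "p * (- 1206 * xv^11 - 684 * xv^9 * u1 - 102 * xv^7 * u1^2 - 6 * xv^5 * u2 - 3 * xv^3 * u3) + half_w * (- 18 * xv^2)"], goal_cases)
  case (3 k)
  show ?case
    using exhaust_4 [of k]
    by (elim disjE; hypsubst; intro poly8_eqI;
        simp add: Cmat_def algebra_simps power_numeral_reduce)
next
  case 11
  show ?case
    unfolding sum_4 vector_4 numeral_eq_cst [symmetric]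
    by (rule poly8_eqI, simp only: ev_simps, rule certificate_33 [THEN eq_iff_diff_eq_0 [THEN iffD2]])
next
  case 5 show ?case unfolding Kx_def by (intro Kx_intros; simp)
next
  case 6 show ?case unfolding Kx_def by (intro Kx_intros; simp)
next
  case 7 show ?case unfolding Kx_def by (intro Kx_intros; simp)
next
  case 8 show ?case unfolding deg_phi_simps by (intro homogeneous_intros; simp)
next
  case 9 show ?case unfolding deg_phi_simps by (intro homogeneous_intros; simp)
next
  case 10 show ?case unfolding deg_phi_simps by (intro homogeneous_intros; simp)
qed (rule Cmat_K Cmat_homogeneous | simp)+

lemma ex_mult_rel: "\<exists>Q. mult_rel i j (\<lambda>k. Cmat i $ k $ j) Q"
proof -
  have sym: "\<exists>Q. mult_rel i j (\<lambda>k. Cmat i $ k $ j) Q" if "\<exists>Q. mult_rel j i (\<lambda>k. Cmat j $ k $ i) Q" for i j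
    using that by (simp add: mult_rel_sym [of i j] Cmat_symmetric [of i _ j])
  have "\<forall>i j. \<exists>Q. mult_rel i j (\<lambda>k. Cmat i $ k $ j) Q"
    unfolding forall_4
    by (intro conjI)
      (rule ex_mult_rel_4 ex_mult_rel_11 ex_mult_rel_12 ex_mult_rel_13 ex_mult_rel_22 ex_mult_rel_23
        ex_mult_rel_33 sym [OF ex_mult_rel_4] sym [OF ex_mult_rel_12] sym [OF ex_mult_rel_13]
        sym [OF ex_mult_rel_23])+
  then show ?thesis by blast
qed

section \<open>Points of the curve\<close>

definition curve_pt :: "(indet \<Rightarrow> complex) \<Rightarrow> bool"
  where "curve_pt z \<longleftrightarrow> z C ^ 2 = ev z q ^ 2 + 4 * ev z p ^ 3 \<and> z A * z B = - (ev z p ^ 3) \<and>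
    z A ^ 2 = (ev z q - z C) * z B / 2 \<and> z B ^ 2 = (ev z q + z C) * z A / 2"

lemma curve_pt_cong:
  assumes "curve_pt z" "f \<approx> g"
  shows "ev z f = ev z g"
  using ev_I [of "f - g" z] assms unfolding I_cong_def curve_pt_def by simp

lemma cubic_scale:
  "cubic t (t * w) x k l m n = t^3 * cubic 1 w x k l m n"
  "cubic_deriv v t (t * w) x k l m n = t^2 * cubic_deriv v 1 w x k l m n"
  by (simp_all add: cubic_def cubic_deriv_def algebra_simps power2_eq_square power3_eq_cube)

lemma ev_half_w: "ev z half_w = (ev z p * ev z b1 / 12 - (z A + z B)) / 2"
  by (simp add: half_w_def)

lemma ev_phi:
  assumes "curve_pt z" "ev z half_w = ev z p * w"
  shows "ev z (\<phi> k) = (z A - z B) * ev z p ^ 2 / 648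
      * cubic_deriv (U k) 1 w (z X) (z (U 1)) (z (U 2)) (z (U 3)) (z (U 4))"
    and "ev z dxW = - ((z A - z B) * ev z p ^ 2 / 648
      * cubic_deriv X 1 w (z X) (z (U 1)) (z (U 2)) (z (U 3)) (z (U 4)))"
  using assms(2) by (simp_all add: curve_pt_cong [OF assms(1) phi_cong]
      curve_pt_cong [OF assms(1) dxW_cong] cubic_scale)

lemma ev_update_ABC: "f \<in> Kx \<Longrightarrow> ev (z(A := a, B := b, C := c)) f = ev z f"
  unfolding Kx_def by (rule ev_cong_polys_in) auto

text \<open>With \<open>v = b1/12 - 2w\<close> the cubic becomes \<open>v^3 + 3 p v + q\<close>, and a root \<open>v\<close> is Cardano's
  \<open>(a + b)/p\<close> where \<open>a/p\<close> and \<open>b/p\<close> are the roots of \<open>X^2 - v X - p\<close>.\<close>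

lemma curve_pt_over_root:
  assumes root: "cubic 1 w (z X) (z (U 1)) (z (U 2)) (z (U 3)) (z (U 4)) = 0"
    and "ev z p \<noteq> 0"
  shows "\<exists>a b c. curve_pt (z(A := a, B := b, C := c)) \<and>
    ev (z(A := a, B := b, C := c)) half_w = ev z p * w \<and>
    (a - b)^2 = ev z p ^ 2 * ((ev z b1 / 12 - 2 * w)^2 + 4 * ev z p)"
proof -
  define P v d where "P = ev z p" and "v = ev z b1 / 12 - 2 * w" and "d = csqrt (v^2 + 4 * P)"
  \<comment> \<open>The value of \<open>c\<close> comes from \<open>q = - (v^3 + 3 P v)\<close> and
    \<open>q^2 + 4 P^3 = (v^2 + 4 P) (v^2 + P)^2\<close>; its sign is the one that the relation for
    \<open>a^2\<close> requires.\<close>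
  define a b c where "a = P * (v + d) / 2" and "b = P * (v - d) / 2" and "c = d * (v^2 + P)"
  define z' where "z' = z(A := a, B := b, C := c)"
  have d: "d^2 = v^2 + 4 * P" by (simp add: d_def)
  have b2: "ev z b2 = - 6 * P - ev z b1 ^ 2 / 24"
    unfolding P_def by (subst b2_conv) simp
  have b3: "ev z b3 = ev z q - ev z b1 ^ 3 / 864 - ev z b1 * ev z b2 / 24"
    by (subst b3_conv) simp
  have "cubic 1 w (z X) (z (U 1)) (z (U 2)) (z (U 3)) (z (U 4))
      = 108 * (ev z b3 + w * ev z b2 + w^2 * ev z b1 - 8 * w^3)"
    by (simp add: cubic_def b_eq)
  also have "\<dots> = 108 * (v^3 + 3 * P * v + ev z q)"
    unfolding b3 b2 v_def by (simp add: field_simps power2_eq_square power3_eq_cube)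
  finally have "108 * (v^3 + 3 * P * v + ev z q) = 0"
    using root by (simp only:)
  then have "v^3 + 3 * P * v + ev z q = 0"
    by (simp only: mult_eq_0_iff) simp
  then have Q: "ev z q = - (v^3 + 3 * P * v)"
    by (metis add.commute eq_neg_iff_add_eq_0)
  have z': "ev z' p = P" "ev z' q = ev z q" "ev z' b1 = ev z b1" "z' A = a" "z' B = b" "z' C = c"
    unfolding z'_def P_def by (simp_all add: ev_update_ABC Kx_pq Kx_b)
  have "a * b = P^2 * (v^2 - d^2) / 4"
    by (simp add: a_def b_def algebra_simps power2_eq_square)
  also have "\<dots> = - (P^3)" unfolding d by (simp add: power2_eq_square power3_eq_cube)
  finally have ab: "a * b = - (P^3)" .
  \<comment> \<open>Eliminating \<open>P\<close> turns the remaining relations into polynomial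
    identities in \<open>v\<close> and \<open>d\<close>.\<close>
  have P: "P = (d^2 - v^2) / 4" using d by simp
  have cc: "c^2 = ev z q ^ 2 + 4 * P^3"
    unfolding c_def Q P by (simp add: field_simps power2_eq_square power3_eq_cube)
  have aa: "a^2 = (ev z q - c) * b / 2"
    unfolding a_def b_def c_def Q P by (simp add: field_simps power2_eq_square power3_eq_cube)
  have bb: "b^2 = (ev z q + c) * a / 2"
    unfolding a_def b_def c_def Q P by (simp add: field_simps power2_eq_square power3_eq_cube)
  have "curve_pt z'"
    unfolding curve_pt_def z' using ab cc aa bb by simp
  moreover have "ev z' half_w = P * w"
    unfolding ev_half_w z' a_def b_def v_def by (simp add: field_simps)
  moreover have "(a - b)^2 = P^2 * (v^2 + 4 * P)"
    unfolding d [symmetric] by (simp add: a_def b_def field_simps power2_eq_square)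
  ultimately show ?thesis unfolding z'_def P_def v_def by blast
qed

section \<open>Uniqueness of the structure constants\<close>

text \<open>The characteristic polynomial of the 27-dimensional representation of \<open>E\<^sub>6\<close> is the cubic, with
  \<open>W\<close> in the role of the degree 9 invariant and the degree 5 invariant equal to \<open>0\<close>. On a root
  hyperplane, whose weights are those of \<open>A\<^sub>5\<close>, it has double roots; this parametrises the common
  zeros of the cubic and its \<open>x\<close>-derivative by the elementary symmetric functions
  \<open>r, 2t, s, e\<close> of degrees 2, 3, 4, 6 (the one of degree 5 vanishes).\<close>

lemma critical_points:
  fixes r t s x :: "'a::idom"
  defines "e \<equiv> - (x^6 + r * x^4 + 2 * t * x^3 + s * x^2)"
  defines "l \<equiv> 4 * r * s - 12 * t^2 - 24 * e"
    and "m \<equiv> 6 * r * e - 2 * s^2"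
    and "n \<equiv> 18 * r * s * e - 108 * t^2 * e - 54 * e^2 - 4 * s^3"
  shows "cubic 1 (t * e) x r l m n = 0"
    and "cubic_deriv X 1 (t * e) x r l m n = 0"
    and "cubic_deriv (U 1) 1 (t * e) x r l m n - 18 * s * e * cubic_deriv (U 4) 1 (t * e) x r l m n = 0"
    and "2 * cubic_deriv (U 2) 1 (t * e) x r l m n + 9 * e * cubic_deriv (U 4) 1 (t * e) x r l m n = 0"
    and "cubic_deriv (U 3) 1 (t * e) x r l m n + 3 * s * cubic_deriv (U 4) 1 (t * e) x r l m n = 0"
  unfolding cubic_unfold assms power_one mult_1_left mult_1_right by Groebner_Basis.algebra+

text \<open>The largest degree is attained by one summand only, so its leading coefficient cannot
  cancel.\<close>

lemma sum_distinct_degrees: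
  fixes f :: "'i \<Rightarrow> 'b::comm_monoid_add poly"
  assumes "finite S" "sum f S = 0"
    and inj: "\<And>i j. i \<in> S \<Longrightarrow> j \<in> S \<Longrightarrow> f i \<noteq> 0 \<Longrightarrow> f j \<noteq> 0 \<Longrightarrow> degree (f i) = degree (f j) \<Longrightarrow> i = j"
    and "i \<in> S"
  shows "f i = 0"
proof (rule ccontr)
  assume "f i \<noteq> 0"
  define T where "T = {i \<in> S. f i \<noteq> 0}"
  have T: "finite T" "T \<noteq> {}"
    using \<open>finite S\<close> \<open>i \<in> S\<close> \<open>f i \<noteq> 0\<close> by (auto simp: T_def)
  define d where "d = Max ((\<lambda>i. degree (f i)) ` T)"
  have "d \<in> (\<lambda>i. degree (f i)) ` T"
    unfolding d_def using T by (intro Max_in) auto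
  then obtain j where j: "j \<in> T" "degree (f j) = d" by blast
  have "coeff (f k) d = 0" if "k \<in> S" "k \<noteq> j" for k
  proof (cases "f k = 0")
    case False
    then have "degree (f k) \<le> d"
      unfolding d_def using T that by (intro Max_ge) (auto simp: T_def)
    moreover have "degree (f k) \<noteq> d"
      using inj [of k j] that j False by (auto simp: T_def)
    ultimately show ?thesis by (simp add: coeff_eq_0)
  qed simp
  then have "coeff (sum f S) d = (\<Sum>k\<in>S. if k = j then coeff (f j) d else 0)"
    unfolding coeff_sum by (intro sum.cong) auto
  also have "\<dots> = coeff (f j) d"
    using j \<open>finite S\<close> by (simp add: T_def)
  also have "\<dots> \<noteq> 0"
    using j by (auto simp: T_def)
  finally show False using assms(2) by simp
qed

text \<open>Composition with the quartic \<open>V\<close> multiplies degrees by 4, so the nonzero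
  summands have degrees 3, 2, 1, 0 modulo 4.\<close>

lemma pcompose_degrees_mod_4:
  fixes f :: "4 \<Rightarrow> complex poly"
  assumes V: "degree V = 4"
    and Y: "\<And>k. Y k \<noteq> 0" "degree (Y 1) = 3" "degree (Y 2) = 2" "degree (Y 3) = 1" "degree (Y 4) = 0"
    and sum: "(\<Sum>k\<in>UNIV. pcompose (f k) V * Y k) = 0"
  shows "f k = 0"
proof -
  have deg: "degree (pcompose (f k) V * Y k) = 4 * degree (f k) + degree (Y k)" if "f k \<noteq> 0" for k
    using that Y(1) V by (simp add: degree_mult_eq degree_pcompose pcompose_eq_0_iff)
  have "pcompose (f k) V * Y k = 0"
  proof (rule sum_distinct_degrees [OF _ sum])
    fix i j :: 4
    assume "pcompose (f i) V * Y i \<noteq> 0" "pcompose (f j) V * Y j \<noteq> 0"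
      "degree (pcompose (f i) V * Y i) = degree (pcompose (f j) V * Y j)"
    then have "4 * degree (f i) + degree (Y i) = 4 * degree (f j) + degree (Y j)"
      by (subst (asm) (1 2) deg) auto
    then have "(4 * degree (f i) + degree (Y i)) mod 4 = (4 * degree (f j) + degree (Y j)) mod 4"
      by simp
    then have "degree (Y i) mod 4 = degree (Y j) mod 4" by simp
    then show "i = j"
      using exhaust_4 [of i] exhaust_4 [of j] Y by auto
  qed auto
  then show ?thesis using Y(1) V by (simp add: pcompose_eq_0_iff)
qed

text \<open>The value 0 at \<open>A\<close>, \<open>B\<close>, \<open>C\<close> is a placeholder
  that elements of \<open>Kx\<close> do not see.\<close>

definition u_pt :: "complex \<Rightarrow> complex \<Rightarrow> complex \<Rightarrow> complex \<Rightarrow> complex \<Rightarrow> indet \<Rightarrow> complex"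
  where "u_pt x k l m n v = (case v of X \<Rightarrow> x | U i \<Rightarrow> if i = 1 then k else if i = 2 then l
    else if i = 3 then m else n | _ \<Rightarrow> 0)"

lemma u_pt_simps [simp]:
  "u_pt x k l m n X = x" "u_pt x k l m n (U 1) = k" "u_pt x k l m n (U 2) = l"
  "u_pt x k l m n (U 3) = m" "u_pt x k l m n (U 4) = n"
  by (simp_all add: u_pt_def)

lemma polyfun_u_pt:
  assumes "polyfun x" "polyfun k" "polyfun l" "polyfun m" "polyfun n"
  shows "polyfun (\<lambda>s. u_pt (x s) (k s) (l s) (m s) (n s) v)"
proof (cases v)
  case (U i)
  then show ?thesis using assms exhaust_4 [of i] by auto
qed (auto simp: u_pt_def assms)

text \<open>At a curve point above a critical point \<open>dxW\<close> vanishes and every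
  \<open>\<phi> k\<close> is a known multiple of \<open>\<phi> 4\<close>, so the relation becomes
  \<open>\<phi> 4\<close> squared times a linear form. The factors kept in front record where
  \<open>p\<close>, \<open>a - b\<close> and \<open>\<phi> 4\<close> may vanish; they are cancelled
  in the next lemma.\<close>

lemma critical_relation:
  fixes e :: "4 \<Rightarrow> poly8" and r t s x :: complex
  defines "y \<equiv> - (x^6 + r * x^4 + 2 * t * x^3 + s * x^2)"
  defines "l \<equiv> 4 * r * s - 12 * t^2 - 24 * y"
    and "m \<equiv> 6 * r * y - 2 * s^2"
    and "n \<equiv> 18 * r * s * y - 108 * t^2 * y - 54 * y^2 - 4 * s^3"
  defines "z \<equiv> u_pt x r l m n"
  assumes e: "\<And>k. e k \<in> K"
    and rel: "(\<Sum>k\<in>UNIV. e k * \<phi> k * \<phi> 4) + g * dxW \<in> I"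
  shows "ev z p * ((ev z b1 / 12 - 2 * (t * y))^2 + 4 * ev z p)
      * cubic_deriv (U 4) 1 (t * y) x r l m n
      * (ev z (e 1) * (18 * s * y) + ev z (e 2) * (- 9/2 * y) + ev z (e 3) * (- 3 * s) + ev z (e 4)) = 0"
proof (cases "ev z p = 0")
  case False
  note crit = critical_points [of t x r s, folded y_def, folded l_def m_def n_def]
  let ?D = "\<lambda>v. cubic_deriv v 1 (t * y) x r l m n"
  have z: "z X = x" "z (U 1) = r" "z (U 2) = l" "z (U 3) = m" "z (U 4) = n"
    by (simp_all add: z_def)
  obtain a b c where pt: "curve_pt (z(A := a, B := b, C := c))"
    and w: "ev (z(A := a, B := b, C := c)) half_w = ev z p * (t * y)"
    and ab: "(a - b)^2 = ev z p ^ 2 * ((ev z b1 / 12 - 2 * (t * y))^2 + 4 * ev z p)"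
    using curve_pt_over_root [of "t * y" z] crit(1) False unfolding z by blast
  define z' where "z' = z(A := a, B := b, C := c)"
  have z': "ev z' p = ev z p" "z' X = x" "z' (U 1) = r" "z' (U 2) = l" "z' (U 3) = m" "z' (U 4) = n"
      "z' A = a" "z' B = b"
    by (simp_all add: z'_def ev_update_ABC Kx_pq z)
  have e': "ev z' (e k) = ev z (e k)" for k
    unfolding z'_def using e [of k] polys_in_mono [of "range U" "insert X (range U)"]
    by (intro ev_update_ABC) (auto simp: K_def Kx_def)
  have w': "ev z' half_w = ev z' p * (t * y)" using w z' by (simp add: z'_def)
  define h where "h = (a - b) * ev z p ^ 2 / 648"
  note phi = ev_phi [OF pt [folded z'_def] w', unfolded z', folded h_def]
  have "(\<Sum>k\<in>UNIV. e k * \<phi> k * \<phi> 4) + g * dxW \<approx> 0"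
    using rel by (simp add: I_cong_def)
  from curve_pt_cong [OF pt [folded z'_def] this]
  have "0 = ev z' ((\<Sum>k\<in>UNIV. e k * \<phi> k * \<phi> 4) + g * dxW)"
    by (simp only: ev_zero)
  also have "\<dots> = h^2 * ?D (U 4) *
      (ev z (e 1) * ?D (U 1) + ev z (e 2) * ?D (U 2) + ev z (e 3) * ?D (U 3) + ev z (e 4) * ?D (U 4))"
    by (simp add: ev_sum sum_4 phi crit(2) e' algebra_simps power2_eq_square)
  also have "?D (U 1) = 18 * s * y * ?D (U 4)"
    using crit(3) by simp
  also have "?D (U 2) = - 9/2 * y * ?D (U 4)"
    using crit(4) by (simp add: field_simps eq_neg_iff_add_eq_0)
  also have "?D (U 3) = - 3 * s * ?D (U 4)"
    using crit(5) by (simp add: eq_neg_iff_add_eq_0)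
  finally have "h^2 * (?D (U 4))^2 * (ev z (e 1) * (18 * s * y) + ev z (e 2) * (- 9/2 * y)
      + ev z (e 3) * (- 3 * s) + ev z (e 4)) = 0"
    by (simp add: algebra_simps power2_eq_square)
  then show ?thesis
    using False ab by (auto simp: h_def power_mult_distrib power_divide)
qed simp


text \<open>Here \<open>y\<close> is free instead of \<open>x\<close>, and the degenerate factors
  are gone: both sides are polynomial along a path that starts where these factors are
  nonzero.\<close>

lemma critical_relation_everywhere:
  fixes e :: "4 \<Rightarrow> poly8" and r t s y :: complex
  defines "l \<equiv> 4 * r * s - 12 * t^2 - 24 * y"
    and "m \<equiv> 6 * r * y - 2 * s^2"
    and "n \<equiv> 18 * r * s * y - 108 * t^2 * y - 54 * y^2 - 4 * s^3"
  defines "z \<equiv> u_pt 0 r l m n"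
  assumes e: "\<And>k. e k \<in> K"
    and rel: "(\<Sum>k\<in>UNIV. e k * \<phi> k * \<phi> 4) + g * dxW \<in> I"
  shows "ev z (e 1) * (18 * s * y) + ev z (e 2) * (- 9/2 * y) + ev z (e 3) * (- 3 * s) + ev z (e 4) = 0"
proof -
  \<comment> \<open>A root of this sextic is an \<open>x\<close> that produces the prescribed
    \<open>y\<close>.\<close>
  have "\<not> constant (poly [:y, 0, s, 2 * t, r, 0, 1:])"
    by (simp add: constant_degree)
  then obtain x where "poly [:y, 0, s, 2 * t, r, 0, 1:] x = 0"
    using fundamental_theorem_of_algebra by blast
  then have y: "y = - (x^6 + r * x^4 + 2 * t * x^3 + s * x^2)"
    by (simp add: algebra_simps power_numeral_reduce eq_neg_iff_add_eq_0)
  \<comment> \<open>The path runs from \<open>x = 1\<close>, \<open>r = t = s = 0\<close> at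
    \<open>c = 0\<close> to the given parameters at \<open>c = 1\<close>.\<close>
  define X' where "X' c = 1 + c * (x - 1)" for c
  define Y where "Y c = - (X' c^6 + (c * r) * X' c^4 + 2 * (c * t) * X' c^3 + (c * s) * X' c^2)" for c
  define L where "L c = 4 * (c * r) * (c * s) - 12 * (c * t)^2 - 24 * Y c" for c
  define M where "M c = 6 * (c * r) * Y c - 2 * (c * s)^2" for c
  define N where "N c = 18 * (c * r) * (c * s) * Y c - 108 * (c * t)^2 * Y c - 54 * Y c^2 - 4 * (c * s)^3"
    for c
  define Z where "Z c = u_pt (X' c) (c * r) (L c) (M c) (N c)" for c
  define gen where "gen c = ev (Z c) p * ((ev (Z c) b1 / 12 - 2 * ((c * t) * Y c))^2 + 4 * ev (Z c) p)
      * cubic_deriv (U 4) 1 ((c * t) * Y c) (X' c) (c * r) (L c) (M c) (N c)" for c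
  define rel_fun where "rel_fun c = ev (Z c) (e 1) * (18 * (c * s) * Y c) + ev (Z c) (e 2) * (- 9/2 * Y c)
      + ev (Z c) (e 3) * (- 3 * (c * s)) + ev (Z c) (e 4)" for c
  have pX: "polyfun X'" unfolding X'_def by (intro polyfun_intros)
  have pY: "polyfun Y" unfolding Y_def by (intro polyfun_intros pX)
  have pL: "polyfun L" "polyfun M" "polyfun N"
    unfolding L_def M_def N_def by (intro polyfun_intros pY)+
  have pZ: "polyfun (\<lambda>c. ev (Z c) f)" for f
    unfolding Z_def by (intro polyfun_ev polyfun_u_pt polyfun_intros pX pL)
  have "rel_fun 1 = 0"
  proof (rule polyfun_eq_0 [of gen rel_fun 0 1])
    show "polyfun gen"
      unfolding gen_def cubic_unfold by (intro polyfun_intros pX pY pL pZ polyfun_divide)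
    show "polyfun rel_fun"
      unfolding rel_fun_def by (intro polyfun_intros pX pY pL pZ)
    show "gen c * rel_fun c = 0" for c
      unfolding gen_def rel_fun_def Z_def N_def M_def L_def Y_def
      by (rule critical_relation [OF e rel, where r = "c * r" and t = "c * t" and s = "c * s" and x = "X' c"])
    \<comment> \<open>The starting point has \<open>x = 1\<close>, \<open>y = - 1\<close>,
      \<open>u\<^sub>1 = u\<^sub>3 = 0\<close>, \<open>u\<^sub>2 = 24\<close>,
      \<open>u\<^sub>4 = - 54\<close>.\<close>
    show "gen 0 \<noteq> 0"
      unfolding gen_def cubic_unfold
      by (simp add: Z_def X'_def Y_def L_def M_def N_def p_def b1_def b2_def)
  qed
  \<comment> \<open>The two points differ only in the coordinate \<open>X\<close>, which does not
    occur in \<open>e k\<close>.\<close>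
  moreover have "ev (Z 1) (e k) = ev z (e k)" for k
  proof (rule ev_cong_polys_in)
    show "e k \<in> polys_in (range U)" using e by (simp add: K_def)
    fix v :: indet assume "v \<in> range U"
    then show "Z 1 v = z v"
      by (auto simp: Z_def z_def u_pt_def L_def M_def N_def l_def m_def n_def Y_def X'_def y)
  qed
  ultimately show ?thesis
    by (simp add: rel_fun_def Y_def X'_def y)
qed

text \<open>It suffices to test points with \<open>u\<^sub>1 \<noteq> 0\<close>. There, with
  \<open>u\<^sub>1\<close>, \<open>u\<^sub>2\<close>, \<open>u\<^sub>3\<close> fixed, the critical
  points form a family in \<open>s\<close> along which each \<open>e k\<close> is a polynomial in
  the quartic \<open>V s\<close>.\<close>

lemma structure_constants_zero:
  fixes e :: "4 \<Rightarrow> poly8"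
  assumes e: "\<And>k. e k \<in> K"
    and rel: "(\<Sum>k\<in>UNIV. e k * \<phi> k * \<phi> 4) + g * dxW \<in> I"
  shows "e k = 0"
proof (rule ev_eq_0_imp_eq_0)
  fix z :: "indet \<Rightarrow> complex"
  assume nz: "z v \<noteq> 0" for v
  define r l m where "r = z (U 1)" and "l = z (U 2)" and "m = z (U 3)"
  have r: "r \<noteq> 0" using nz by (simp add: r_def)
  have "\<exists>f. \<forall>n. ev (u_pt 0 r l m n) (e k) = poly f n" for k
    unfolding polyfun_def [symmetric] by (intro polyfun_ev polyfun_u_pt polyfun_intros)
  then obtain f where f: "\<And>k n. ev (u_pt 0 r l m n) (e k) = poly (f k) n"
    by metis
  \<comment> \<open>As a polynomial in \<open>s\<close>, \<open>y\<close> solves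
    \<open>m = 6 r y - 2 s^2\<close>; \<open>V\<close> is the value of \<open>u\<^sub>4\<close>
    after \<open>t^2\<close> has been eliminated by means of \<open>l\<close>, and \<open>Y\<close>
    lists the multipliers of the four coefficients.\<close>
  define y where "y = [:m / (6 * r), 0, 1 / (3 * r):]"
  define V where "V = [:0, - 18 * r:] * y + smult 162 (y^2) + smult (9 * l) y - [:0, 0, 0, 4:]"
  define Y where "Y k = (if k = 1 then [:0, 18:] * y else if k = 2 then smult (- 9/2) y
      else if k = 3 then [:0, - 3:] else 1)" for k :: 4
  have V: "V = [:162 * (m / (6 * r))^2 + 9 * l * (m / (6 * r)), - 3 * m,
      54 * m / (3 * r^2) + 3 * l / r, - 10, 18 / r^2:]"
    using r by (simp add: V_def y_def power2_eq_square field_simps)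
  have "f k = 0"
  proof (rule pcompose_degrees_mod_4)
    show "degree V = 4" using r by (simp add: V)
    show "Y k \<noteq> 0" for k using r by (simp add: Y_def y_def)
    show "degree (Y 1) = 3" "degree (Y 2) = 2" "degree (Y 3) = 1" "degree (Y 4) = 0"
      using r by (simp_all add: Y_def y_def)
    have "poly (\<Sum>k\<in>UNIV. pcompose (f k) V * Y k) s = 0" for s
    proof -
      define c where "c = (m + 2 * s^2) / (6 * r)"
      \<comment> \<open>Either square root will do, since \<open>l\<close> and
        \<open>u\<^sub>4\<close> involve only \<open>t^2\<close> and the linear relation does not
        involve \<open>t\<close>.\<close>
      define t where "t = csqrt ((4 * r * s - 24 * c - l) / 12)"
      have t: "t^2 = (4 * r * s - 24 * c - l) / 12" by (simp add: t_def)
      have y: "poly y s = c"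
        using r by (simp add: y_def c_def field_simps power2_eq_square)
      have l: "4 * r * s - 12 * t^2 - 24 * c = l" unfolding t by (simp add: field_simps)
      have m: "6 * r * c - 2 * s^2 = m" using r by (simp add: c_def)
      have n: "18 * r * s * c - 108 * t^2 * c - 54 * c^2 - 4 * s^3 = poly V s"
        unfolding t V_def by (simp add: y field_simps power2_eq_square power3_eq_cube)
      show ?thesis
        using critical_relation_everywhere [OF e rel, of r s t c, unfolded l m n]
        by (simp add: sum_4 poly_sum poly_pcompose f Y_def y mult_ac)
    qed
    then show "(\<Sum>k\<in>UNIV. pcompose (f k) V * Y k) = 0"
      by (simp add: poly_all_0_iff_0 [symmetric])
  qed
  moreover have "ev z (e k) = ev (u_pt 0 r l m (z (U 4))) (e k)"
  proof (rule ev_cong_polys_in)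
    show "e k \<in> polys_in (range U)" using e by (simp add: K_def)
    fix v :: indet assume "v \<in> range U"
    then obtain i where "v = U i" by blast
    then show "z v = u_pt 0 r l m (z (U 4)) v"
      using exhaust_4 [of i] by (auto simp: r_def l_def m_def)
  qed
  ultimately show "ev z (e k) = 0" by (simp add: f)
qed

section \<open>Uniqueness of \<open>Q\<close>\<close>

text \<open>Up to a power of the leading coefficient \<open>d0\<close>, the resultant of \<open>d0 w^2 + d1 w + d2\<close> and
  \<open>c0 w^3 + c1 w^2 + c2 w + c3\<close>; \<open>r1 w + r0\<close> is the pseudo-remainder of the cubic.\<close>

definition quadratic_cubic_res :: "'a \<Rightarrow> 'a \<Rightarrow> 'a \<Rightarrow> 'a \<Rightarrow> 'a \<Rightarrow> 'a \<Rightarrow> 'a \<Rightarrow> 'a::comm_ring_1"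
  where "quadratic_cubic_res d0 d1 d2 c0 c1 c2 c3 =
    (let r1 = (c2 * d0 - c0 * d2) * d0 - (c1 * d0 - c0 * d1) * d1;
         r0 = c3 * d0^2 - (c1 * d0 - c0 * d1) * d2
     in d0 * r0^2 - d1 * r0 * r1 + d2 * r1^2)"

lemma quadratic_cubic_res_eq_0:
  fixes w :: complex
  assumes quad: "d0 * w^2 + d1 * w + d2 = 0" and cub: "c0 * w^3 + c1 * w^2 + c2 * w + c3 = 0"
  shows "quadratic_cubic_res d0 d1 d2 c0 c1 c2 c3 = 0"
proof -
  define r1 r0 where "r1 = (c2 * d0 - c0 * d2) * d0 - (c1 * d0 - c0 * d1) * d1"
    and "r0 = c3 * d0^2 - (c1 * d0 - c0 * d1) * d2"
  have "r1 * w + r0 = d0^2 * (c0 * w^3 + c1 * w^2 + c2 * w + c3)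
      - (c0 * d0 * w + (c1 * d0 - c0 * d1)) * (d0 * w^2 + d1 * w + d2)"
    by (simp add: r1_def r0_def algebra_simps power2_eq_square power3_eq_cube)
  then have "r0 = - (r1 * w)" using quad cub by (simp add: add_eq_0_iff)
  then have "d0 * r0^2 - d1 * r0 * r1 + d2 * r1^2 = r1^2 * (d0 * w^2 + d1 * w + d2)"
    by (simp add: algebra_simps power2_eq_square)
  then show ?thesis
    unfolding quadratic_cubic_res_def Let_def r1_def r0_def quad by simp
qed

text \<open>Eliminates \<open>W\<close> from the cubic and its \<open>x\<close>-derivative: where
  this polynomial in \<open>x\<close> and \<open>u\<close> is nonzero, no branch of \<open>W\<close>
  is critical.\<close>

definition crit_res :: "'a \<Rightarrow> 'a \<Rightarrow> 'a \<Rightarrow> 'a \<Rightarrow> 'a \<Rightarrow> 'a::comm_ring_1"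
  where "crit_res x k l m n = quadratic_cubic_res (108 * G2 X x k l m n) (36 * G1 X x k l m n)
    (G0 X x k l m n) (- 864) (108 * B1 x k l m n) (36 * B2 x k l m n) (B3 x k l m n)"

lemma crit_res_eq_0:
  fixes w :: complex
  assumes "cubic_deriv X 1 w x k l m n = 0" "cubic 1 w x k l m n = 0"
  shows "crit_res x k l m n = 0"
  unfolding crit_res_def
  by (rule quadratic_cubic_res_eq_0 [of _ w])
     (use assms in \<open>simp_all add: cubic_deriv_def cubic_def algebra_simps\<close>)

lemma ev_crit_res [simp]:
  "ev z (crit_res x k l m n) = crit_res (ev z x) (ev z k) (ev z l) (ev z m) (ev z n)"
  by (simp add: crit_res_def quadratic_cubic_res_def Let_def)

section \<open>The six points over a generic \<open>(x, u)\<close>\<close>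

lemma exists_cube_root:
  fixes y :: complex
  shows "\<exists>a. a^3 = y"
proof -
  have "\<not> constant (poly [:- y, 0, 0, 1:])"
    by (simp add: constant_degree)
  then obtain a where "poly [:- y, 0, 0, 1:] a = 0"
    using fundamental_theorem_of_algebra by blast
  then have "a^3 = y" by (simp add: power3_eq_cube algebra_simps)
  then show ?thesis ..
qed

lemma exists_cube_root_of_unity: "\<exists>\<omega>::complex. \<omega>^2 + \<omega> + 1 = 0 \<and> \<omega>^3 = 1 \<and> \<omega> \<noteq> 1"
proof -
  define s where "s = csqrt (- 3)"
  have s: "s * s = - 3" using power2_csqrt [of "- 3"] by (simp add: s_def power2_eq_square)
  define \<omega> where "\<omega> = (s - 1) / 2"
  have 1: "\<omega>^2 + \<omega> + 1 = 0"
    by (simp add: \<omega>_def power2_eq_square field_simps s)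
  have "\<omega>^3 - 1 = (\<omega> - 1) * (\<omega>^2 + \<omega> + 1)"
    by (simp add: algebra_simps power2_eq_square power3_eq_cube)
  then have "\<omega>^3 = 1" by (simp add: 1)
  with 1 show ?thesis by force
qed

text \<open>The condition on \<open>a^3\<close> is the relation for \<open>a^2\<close> multiplied by
  \<open>a\<close>, with \<open>a b\<close> replaced by \<open>- p^3\<close>. Two signs of
  \<open>c\<close> and three cube roots yield the six points.\<close>

lemma curve_pt_cube_root:
  assumes c: "c^2 = ev z q ^ 2 + 4 * ev z p ^ 3" and a: "a^3 = - (ev z p ^ 3) * (ev z q - c) / 2"
    and p: "ev z p \<noteq> 0"
  shows "a \<noteq> 0" and "curve_pt (z(A := a, B := - (ev z p ^ 3) / a, C := c))"
proof -
  let ?P = "ev z p" and ?q = "ev z q"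
  have qc: "(?q - c) * (?q + c) = - 4 * ?P^3"
    using c by (simp add: algebra_simps power2_eq_square)
  then have "?q - c \<noteq> 0" using p by auto
  then show a0: "a \<noteq> 0" using a p by auto
  have aa: "a^2 = (?q - c) * (- (?P^3) / a) / 2"
    using a a0 by (simp add: field_simps power2_eq_square power3_eq_cube)
  have "(- (?P^3) / a)^2 = (?P^3)^2 / a^2"
    by (simp add: power_divide)
  also have "(?P^3)^2 = - (?P^3) * ((?q - c) * (?q + c)) / 4"
    unfolding qc by (simp add: power2_eq_square)
  also have "\<dots> = a^3 * (?q + c) / 2"
    unfolding a by simp
  also have "\<dots> / a^2 = (?q + c) * a / 2"
    using a0 by (simp add: power2_eq_square power3_eq_cube)
  finally have bb: "(- (?P^3) / a)^2 = (?q + c) * a / 2" .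
  show "curve_pt (z(A := a, B := - (?P ^ 3) / a, C := c))"
    unfolding curve_pt_def using aa bb c a0 by (simp add: ev_update_ABC Kx_pq)
qed

text \<open>The resultant keeps the \<open>x\<close>-derivative of the cubic away from 0. Moreover
  \<open>a = b\<close> would give \<open>c a = 0\<close> by comparing the relations for
  \<open>a^2\<close> and \<open>b^2\<close>, although \<open>a b = - p^3\<close> is nonzero.\<close>

lemma ev_dxW_nonzero:
  assumes pt: "curve_pt z" and p: "ev z p \<noteq> 0" and C: "z C \<noteq> 0"
    and res: "crit_res (z X) (z (U 1)) (z (U 2)) (z (U 3)) (z (U 4)) \<noteq> 0"
  shows "ev z dxW \<noteq> 0"
proof -
  define w where "w = ev z half_w / ev z p"
  have w: "ev z half_w = ev z p * w" using p by (simp add: w_def)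
  have "cubic p half_w xv u1 u2 u3 u4 \<approx> 0"
    by (simp add: I_cong_def cubic_I)
  from curve_pt_cong [OF pt this]
  have "cubic 1 w (z X) (z (U 1)) (z (U 2)) (z (U 3)) (z (U 4)) = 0"
    using p by (simp add: w cubic_scale)
  with res have "cubic_deriv X 1 w (z X) (z (U 1)) (z (U 2)) (z (U 3)) (z (U 4)) \<noteq> 0"
    using crit_res_eq_0 by blast
  moreover have "z A \<noteq> z B"
  proof
    assume "z A = z B"
    with pt have "(ev z q - z C) * z A = (ev z q + z C) * z A" and "z A * z A = - (ev z p ^ 3)"
      unfolding curve_pt_def by auto
    then show False using C p by (auto simp: algebra_simps)
  qed
  ultimately show ?thesis
    using p by (simp add: ev_phi [OF pt w])
qed

text \<open>At generic points \<open>dxW\<close> can be cancelled, so the bracket vanishes at all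
  six points. The three cube roots separate the parts in \<open>a b\<close>, \<open>a\<close> and
  \<open>b\<close>, and the two signs of \<open>c\<close> split each part in two.\<close>

lemma Q_zero:
  assumes Kx: "p1 \<in> Kx" "p2 \<in> Kx" "p3 \<in> Kx" "p4 \<in> Kx" "p5 \<in> Kx" "p6 \<in> Kx"
    and g: "(av * bv * p1 + av * p2 + bv * p3 + av * bv * cv * p4 + av * cv * p5 + bv * cv * p6) * dxW \<in> I"
      (is "?g * dxW \<in> I")
  shows "p1 = 0" "p2 = 0" "p3 = 0" "p4 = 0" "p5 = 0" "p6 = 0"
proof -
  \<comment> \<open>The first two factors keep \<open>p\<close> and \<open>c\<close> nonzero, so
    that the six points are distinct; the third keeps \<open>dxW\<close> nonzero at them.\<close>
  define gen where "gen = p * (q^2 + 4 * p^3) * crit_res xv u1 u2 u3 u4"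
  have *: "ev z p1 = 0 \<and> ev z p2 = 0 \<and> ev z p3 = 0 \<and> ev z p4 = 0 \<and> ev z p5 = 0 \<and> ev z p6 = 0"
    if "ev z gen \<noteq> 0" for z
  proof -
    from that have p: "ev z p \<noteq> 0" and disc: "ev z q ^ 2 + 4 * ev z p ^ 3 \<noteq> 0"
      and res: "crit_res (z X) (z (U 1)) (z (U 2)) (z (U 3)) (z (U 4)) \<noteq> 0"
      by (auto simp: gen_def)
    define P where "P = ev z p ^ 3"
    have P: "P \<noteq> 0" using p by (simp add: P_def)
    have coeffs: "ev z p1 + c * ev z p4 = 0 \<and> ev z p2 + c * ev z p5 = 0 \<and> ev z p3 + c * ev z p6 = 0"
      if c: "c^2 = ev z q ^ 2 + 4 * ev z p ^ 3" for c
    proof -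
      define e1 e2 e3 where "e1 = ev z p1 + c * ev z p4" and "e2 = ev z p2 + c * ev z p5"
        and "e3 = ev z p3 + c * ev z p6"
      have rel: "- P * e1 + a * e2 + (- P / a) * e3 = 0" and nz: "a \<noteq> 0"
        if a: "a^3 = - P * (ev z q - c) / 2" for a
      proof -
        define z' where "z' = z(A := a, B := - P / a, C := c)"
        note pt = curve_pt_cube_root [OF c a [unfolded P_def] p, folded P_def, folded z'_def]
        show "a \<noteq> 0" by (rule pt(1))
        have Kx_z': "ev z' f = ev z f" if "f \<in> Kx" for f
          unfolding z'_def using that by (rule ev_update_ABC)
        have "c \<noteq> 0" using c disc by auto
        then have "ev z' dxW \<noteq> 0"
          using p res by (intro ev_dxW_nonzero pt) (auto simp: Kx_z' Kx_pq, auto simp: z'_def)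
        moreover have "?g * dxW \<approx> 0" using g by (simp add: I_cong_def)
        from curve_pt_cong [OF pt(2) this] have "ev z' ?g * ev z' dxW = 0" by simp
        ultimately have "ev z' ?g = 0" by simp
        then show "- P * e1 + a * e2 + (- P / a) * e3 = 0"
          using pt(1) by (simp add: Kx_z' Kx e1_def e2_def e3_def) (simp add: z'_def algebra_simps add_divide_distrib)
      qed
      obtain a where a: "a^3 = - P * (ev z q - c) / 2" using exists_cube_root by blast
      obtain \<omega> :: complex where \<omega>: "\<omega>^2 + \<omega> + 1 = 0" "\<omega>^3 = 1" "\<omega> \<noteq> 1"
        using exists_cube_root_of_unity by blast
      have a0: "a \<noteq> 0" using a by (rule nz)
      have \<omega>0: "\<omega> \<noteq> 0" using \<omega>(2) by auto
      have inv: "1 / \<omega> = \<omega>^2" "1 / \<omega>^2 = \<omega>"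
        using \<omega>(2) \<omega>0 by (simp_all add: field_simps power2_eq_square power3_eq_cube)
      have inv_mult: "- P / (y * a) = (1 / y) * (- P / a)" for y
        by simp
      have r0: "- P * e1 + a * e2 + (- P / a) * e3 = 0"
        using a by (rule rel)
      have "- P * e1 + (\<omega> * a) * e2 + (- P / (\<omega> * a)) * e3 = 0"
        by (rule rel) (simp add: power_mult_distrib \<omega> a)
      then have r1: "- P * e1 + \<omega> * (a * e2) + \<omega>^2 * ((- P / a) * e3) = 0"
        unfolding inv_mult [of \<omega>] inv by (simp only: mult.assoc)
      have "(\<omega>^2 * a)^3 = (\<omega>^3)^2 * a^3"
        by (simp add: algebra_simps power2_eq_square power3_eq_cube)
      then have "(\<omega>^2 * a)^3 = - P * (ev z q - c) / 2"
        by (simp add: \<omega>(2) a)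
      from rel [OF this] have "- P * e1 + (\<omega>^2 * a) * e2 + (- P / (\<omega>^2 * a)) * e3 = 0"
        .
      then have r2: "- P * e1 + \<omega>^2 * (a * e2) + \<omega> * ((- P / a) * e3) = 0"
        unfolding inv_mult [of "\<omega>^2"] inv by (simp only: mult.assoc)
      \<comment> \<open>Discrete Fourier inversion over the three cube roots: the sum of the
        equations isolates \<open>e1\<close>, and two of them then give \<open>e2\<close>.\<close>
      have "3 * (- P * e1) = (- P * e1 + a * e2 + (- P / a) * e3)
          + (- P * e1 + \<omega> * (a * e2) + \<omega>^2 * ((- P / a) * e3))
          + (- P * e1 + \<omega>^2 * (a * e2) + \<omega> * ((- P / a) * e3))
          - (\<omega>^2 + \<omega> + 1) * (a * e2 + (- P / a) * e3)"
        by (simp add: algebra_simps)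
      then have e1: "e1 = 0" unfolding r0 r1 r2 \<omega>(1) using P by simp
      have "(\<omega> - 1) * (a * e2) * \<omega> = (- P * e1 + \<omega>^2 * (a * e2) + \<omega> * ((- P / a) * e3))
          - \<omega> * (- P * e1 + a * e2 + (- P / a) * e3) - (\<omega> - 1) * P * e1"
        by (simp add: algebra_simps power2_eq_square)
      then have e2: "e2 = 0" unfolding r0 r2 using e1 \<omega>0 \<omega>(3) a0 by simp
      from r0 have e3: "e3 = 0" using e1 e2 P a0 by simp
      from e1 e2 e3 show ?thesis by (simp add: e1_def e2_def e3_def)
    qed
    define c where "c = csqrt (ev z q ^ 2 + 4 * ev z p ^ 3)"
    have c: "c^2 = ev z q ^ 2 + 4 * ev z p ^ 3" by (simp add: c_def)
    have "c \<noteq> 0" using c disc by auto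
    \<comment> \<open>The equations for \<open>c\<close> and \<open>- c\<close> together separate
      the two components of each part.\<close>
    moreover have "u = 0 \<and> v = 0" if "u + c * v = 0" "u + (- c) * v = 0" for u v
      using that \<open>c \<noteq> 0\<close> by (auto simp: add_eq_0_iff)
    ultimately show ?thesis
      using coeffs [OF c] coeffs [of "- c", unfolded power2_minus, OF c] by blast
  qed
  \<comment> \<open>The point \<open>x = 1\<close>, all \<open>u\<^sub>i = 0\<close> witnesses that
    \<open>gen\<close> is not the zero polynomial.\<close>
  have "ev (\<lambda>v. if v = X then 1 else 0) gen \<noteq> 0"
  proof -
    have "crit_res (1::complex) 0 0 0 0 \<noteq> 0"
      by (simp add: crit_res_def B_defs quadratic_cubic_res_def)
    moreover have "ev (\<lambda>v. if v = X then 1 else 0) p = - 2781"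
      by (simp add: p_def b1_def b2_def)
    moreover have "ev (\<lambda>v. if v = X then 1 else 0) q = - 293301"
      by (simp add: q_def b1_def b2_def b3_def)
    ultimately show ?thesis by (simp add: gen_def)
  qed
  from ev_vanish_generically [OF _ this] * 
  show "p1 = 0" "p2 = 0" "p3 = 0" "p4 = 0" "p5 = 0" "p6 = 0" by blast+
qed

text \<open>The difference of two relations has left side 0. Its coefficients vanish first, by the
  critical points; then only \<open>g * dxW\<close> is left in \<open>I\<close>, and
  \<open>Q_zero\<close> applies.\<close>

lemma mult_rel_unique:
  assumes "mult_rel i j c Q" "mult_rel i j c' Q'"
  shows "c = c' \<and> Q = Q'"
proof -
  let ?g = "\<lambda>p1 p2 p3 p4 p5 p6. av * bv * p1 + av * p2 + bv * p3 + av * bv * cv * p4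
    + av * cv * p5 + bv * cv * p6"
  have adm: "admissible_Q i j Q" "admissible_Q i j Q'"
    using assms unfolding mult_rel_def by simp_all
  obtain p1 p2 p3 p4 p5 p6 where Kx: "p1 \<in> Kx" "p2 \<in> Kx" "p3 \<in> Kx" "p4 \<in> Kx" "p5 \<in> Kx" "p6 \<in> Kx"
    and Q: "Q = cls (?g p1 p2 p3 p4 p5 p6)"
    using adm(1) unfolding admissible_Q_def Let_def by blast
  obtain p1' p2' p3' p4' p5' p6'
    where Kx': "p1' \<in> Kx" "p2' \<in> Kx" "p3' \<in> Kx" "p4' \<in> Kx" "p5' \<in> Kx" "p6' \<in> Kx"
    and Q': "Q' = cls (?g p1' p2' p3' p4' p5' p6')"
    using adm(2) unfolding admissible_Q_def Let_def by blast
  define g where "g = ?g (p1 - p1') (p2 - p2') (p3 - p3') (p4 - p4') (p5 - p5') (p6 - p6')"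
  have g: "g = ?g p1 p2 p3 p4 p5 p6 - ?g p1' p2' p3' p4' p5' p6'"
    by (simp add: g_def algebra_simps)
  have "cls (\<phi> i * \<phi> j) = cls (\<Sum>k\<in>UNIV. c k * \<phi> k * \<phi> 4) \<oplus>\<^bsub>quot\<^esub> Q \<otimes>\<^bsub>quot\<^esub> cls dxW"
    and "cls (\<phi> i * \<phi> j) = cls (\<Sum>k\<in>UNIV. c' k * \<phi> k * \<phi> 4) \<oplus>\<^bsub>quot\<^esub> Q' \<otimes>\<^bsub>quot\<^esub> cls dxW"
    using assms unfolding mult_rel_def by simp_all
  then have "cls ((\<Sum>k\<in>UNIV. c k * \<phi> k * \<phi> 4) + ?g p1 p2 p3 p4 p5 p6 * dxW)
      = cls ((\<Sum>k\<in>UNIV. c' k * \<phi> k * \<phi> 4) + ?g p1' p2' p3' p4' p5' p6' * dxW)"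
    unfolding Q Q' cls_mult cls_add by (rule trans [OF sym])
  moreover have diff: "(\<Sum>k\<in>UNIV. (c k - c' k) * \<phi> k * \<phi> 4) + (a - b) * dxW
      = ((\<Sum>k\<in>UNIV. c k * \<phi> k * \<phi> 4) + a * dxW) - ((\<Sum>k\<in>UNIV. c' k * \<phi> k * \<phi> 4) + b * dxW)"
    for a b
    by (simp add: sum_subtractf left_diff_distrib)
  ultimately have rel: "(\<Sum>k\<in>UNIV. (c k - c' k) * \<phi> k * \<phi> 4) + g * dxW \<in> I"
    unfolding cls_eq_iff g by (simp only: diff)
  have "c k - c' k \<in> K" for k
    using assms unfolding mult_rel_def K_def by (intro polys_in_minus) simp_all
  from structure_constants_zero [OF this rel] have c: "c k - c' k = 0" for k .
  then have "g * dxW \<in> I" using rel by simp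
  note zero = Q_zero [OF Kx_closed(2) [OF Kx(1) Kx'(1)] Kx_closed(2) [OF Kx(2) Kx'(2)]
    Kx_closed(2) [OF Kx(3) Kx'(3)] Kx_closed(2) [OF Kx(4) Kx'(4)] Kx_closed(2) [OF Kx(5) Kx'(5)]
    Kx_closed(2) [OF Kx(6) Kx'(6)] this [unfolded g_def]]
  have "Q = Q'"
    using zero unfolding Q Q' by simp
  moreover have "c = c'"
    using c by (intro ext) simp
  ultimately show ?thesis by simp
qed

theorem mainTheorem1:
  shows "(\<forall>i j. \<exists>!(c, Q). mult_rel i j c Q) \<and>
    (\<forall>(c :: 4 \<Rightarrow> 4 \<Rightarrow> 4 \<Rightarrow> poly8) (Q :: 4 \<Rightarrow> 4 \<Rightarrow> poly8 set) (M :: 4 \<Rightarrow> poly8^4^4).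
      (\<forall>i j. mult_rel i j (c i j) (Q i j)) \<and> (\<forall>i. M i = (\<chi> k j. c i j k)) \<longrightarrow>
      M 4 = mat 1 \<and>
      M 1 = vector
        [vector [u1 * (cst (250/243) * u1^4 - cst (10/9) * u1 * u2 - cst (7/3) * u3),
                 - cst (25/54) * u1^3 + cst (1/4) * u2,
                 - cst (5/3) * u1^2,
                 1],
         vector [cst (100/81) * u1^4 * u2 + cst (140/27) * u1^3 * u3 - cst (2/3) * u1 * u2^2
                   - cst (4/3) * u1 * u4 - 2 * u2 * u3,
                 u1 * (- cst (5/9) * u1 * u2 - cst (7/3) * u3),
                 - 6 * u3 - 2 * u1 * u2,
                 0],
         vector [- cst (2/9) * u1 * u2 * u3 - cst (2/3) * u3^2 + cst (100/243) * u1^4 * u3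
                   - cst (10/27) * u1^2 * u4,
                 cst (1/6) * u4 - cst (5/27) * u1^2 * u3,
                 - cst (2/3) * u1 * u3,
                 0],
         vector [cst (10/9) * u1^2 * u3^2 - cst (1/3) * u1 * u2 * u4 - u3 * u4
                   + cst (50/81) * u1^4 * u4,
                 - cst (1/2) * u3^2 - cst (5/18) * u1^2 * u4,
                 - u1 * u4,
                 0]] \<and>
      M 2 = vector
        [vector [- cst (25/54) * u1^3 + cst (1/4) * u2, cst (5/24) * u1, cst (3/4), 0],
         vector [u1 * (- cst (5/9) * u1 * u2 - cst (7/3) * u3), cst (1/4) * u2, 0, 1],
         vector [cst (1/6) * u4 - cst (5/27) * u1^2 * u3, cst (1/12) * u3, 0, 0],
         vector [- cst (1/2) * u3^2 - cst (5/18) * u1^2 * u4, cst (1/8) * u4, 0, 0]] \<and>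
      M 3 = vector
        [vector [- cst (5/3) * u1^2, cst (3/4), 0, 0],
         vector [- 6 * u3 - 2 * u1 * u2, 0, - 6 * u1, 0],
         vector [- cst (2/3) * u1 * u3, 0, 0, 1],
         vector [- u1 * u4, 0, - cst (9/2) * u3, 0]])"
proof (rule conjI, goal_cases)
  case 1
  show ?case
  proof (intro allI)
    fix i j
    obtain Q where Q: "mult_rel i j (\<lambda>k. Cmat i $ k $ j) Q"
      using ex_mult_rel by blast
    show "\<exists>!(c, Q). mult_rel i j c Q"
    proof (rule ex1I [of _ "(\<lambda>k. Cmat i $ k $ j, Q)"])
      fix cQ assume *: "case cQ of (c, Q) \<Rightarrow> mult_rel i j c Q"
      obtain c Q' where cQ: "cQ = (c, Q')" by (cases cQ)
      with * have "mult_rel i j c Q'" by simp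
      from mult_rel_unique [OF this Q] cQ show "cQ = (\<lambda>k. Cmat i $ k $ j, Q)" by simp
    qed (simp add: Q)
  qed
next
  case 2
  show ?case
  proof (intro allI impI, goal_cases)
    case (1 c Q M)
    have c: "c i j = (\<lambda>k. Cmat i $ k $ j)" for i j
    proof -
      obtain Q' where Q': "mult_rel i j (\<lambda>k. Cmat i $ k $ j) Q'"
        using ex_mult_rel by blast
      have "mult_rel i j (c i j) (Q i j)" using 1 by blast
      from mult_rel_unique [OF this Q'] show ?thesis ..
    qed
    have M: "M i = Cmat i" for i
    proof -
      have "M i = (\<chi> k j. c i j k)" using 1 by blast
      then show ?thesis by (simp add: vec_eq_iff c)
    qed
    show ?case
      unfolding M by (simp only: Cmat_def four_eq_simps if_True if_False simp_thms)
  qed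
qed

end
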